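(* Let $\Delta>0$. The following condition (A) on a Lévy process is satisfied in each of the cases (i)–(iv) below. Condition (A): for some $\varepsilon>0$, (a) $\int \max(|x|,|x|^{2+\varepsilon})\,\nu(dx)<\infty$; (b) $x\nu$ has a bounded Lebesgue density and $|\mathcal F[x\nu](u)|\lesssim(1+|u|)^{-1}$; (c) $(1+|u|)^{-1+\varepsilon}\varphi^{-1}(u)\in L^2(\mathbb R)$. Cases: (i) a compound Poisson process whenever the jump law has a density $\nu$ such that $x\nu$ is of bounded variation and $\nu$ has a finite $(2+\varepsilon)$-moment for some $\varepsilon>0$; (ii) a Gamma process with parameters $\alpha\in(0,1/(2\Delta))$ and $\lambda>0$; (iii) a pure-jump self-decomposable process whenever its $k$-function satisfies $\int\max(1,|x|^{1+\varepsilon})k(x)\,dx<\infty$ for some $\varepsilon>0$ and $k(0-)+k(0+)<1/(2\Delta)$; (iv) any Lévy process which is a sum of independent compound Poisson and self-decomposable processes of the preceding types (i)–(iii).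
   Context: $(L_t)_{t\ge0}$ is a real-valued Lévy process of locally finite variation without Gaussian part, with Lévy measure $\nu$; $\varphi(u)=E[e^{iuL_\Delta}]=e^{\Delta\psi(u)}$ with $\psi(u)=i\gamma u+\int_{\mathbb R\setminus\{0\}}(e^{iux}-1)\,\nu(dx)$, $\gamma\in\mathbb R$. $\varphi^{-1}=1/\varphi$; $x\nu$ denotes the signed measure $x\,\nu(dx)$ (or its density); $\mathcal F\mu(u)=\int e^{iux}\mu(dx)$; $A\lesssim B$ means $A\le CB$ with $C$ independent of $u\in\mathbb R$. In (i), the Lévy measure of a compound Poisson process is the (finite) intensity times the jump law, so the density of the Lévy measure is proportional to the density of the jump law. Gamma process with parameters $\alpha,\lambda$: $L_\Delta\sim\Gamma(\alpha\Delta,\lambda)$, Lévy measure $\nu(dx)=\alpha x^{-1}e^{-\lambda x}\mathbf 1_{(0,\infty)}(x)\,dx$ and $\varphi(u)=(1-iu/\lambda)^{-\alpha\Delta}$. Pure-jump self-decomposable process: no Gaussian part and $\nu(dx)=k(x)|x|^{-1}dx$, where the $k$-function $k\ge0$ is increasing on $(-\infty,0)$ and decreasing on $(0,\infty)$; $k(0\pm)$ are its one-sided limits at $0$.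
   Formalization: In (iv) the total of k(0-)+k(0+) over all self-decomposable components (α for a Gamma component) is required to be below 1/(2Δ); bounding each component separately is not enough, e.g. two independent Gamma processes with α=2/(5Δ) and the same λ violate (c). *)

theory Defs
  imports "HOL-Probability.Probability"
begin

section \<open>Functions of bounded variation\<close>

definition bounded_variation_on :: "real set \<Rightarrow> (real \<Rightarrow> real) \<Rightarrow> bool" where
  "bounded_variation_on S f \<longleftrightarrow>
     (\<exists>B. \<forall>(n::nat) t. (\<forall>i\<le>n. t i \<in> S) \<longrightarrow> (\<forall>i<n. t i \<le> t (Suc i)) \<longrightarrow>
        (\<Sum>i<n. \<bar>f (t (Suc i)) - f (t i)\<bar>) \<le> B)"


section \<open>Levy processes\<close>

text \<open>Processes are indexed by all reals, but only the times \<open>t \<ge> 0\<close> are ever referred to.\<close>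

definition levy_process :: "'a measure \<Rightarrow> (real \<Rightarrow> 'a \<Rightarrow> real) \<Rightarrow> bool" where
  "levy_process M L \<longleftrightarrow>
     prob_space M \<and>
     (\<forall>t\<ge>0. L t \<in> borel_measurable M) \<and>
     (AE \<omega> in M. L 0 \<omega> = 0) \<and>
     (\<forall>(n::nat) t. 0 \<le> t 0 \<longrightarrow> (\<forall>i<n. t i \<le> t (Suc i)) \<longrightarrow>
        prob_space.indep_vars M (\<lambda>_. borel) (\<lambda>i \<omega>. L (t (Suc i)) \<omega> - L (t i) \<omega>) {..<n}) \<and>
     (\<forall>s\<ge>0. \<forall>t\<ge>0. distr M borel (\<lambda>\<omega>. L (s + t) \<omega> - L s \<omega>) = distr M borel (L t)) \<and>
     (AE \<omega> in M. \<forall>t\<ge>0. ((\<lambda>s. L s \<omega>) \<longlongrightarrow> L t \<omega>) (at_right t) \<and>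
                        (0 < t \<longrightarrow> (\<exists>l. ((\<lambda>s. L s \<omega>) \<longlongrightarrow> l) (at_left t))))"

text \<open>Levy measures live on the nonzero reals; they are represented as Borel measures on the
  whole line without an atom at \<open>0\<close>. Integrability of \<open>min 1 \<bar>x\<bar>\<close> is the finite variation case.\<close>

definition fv_levy_measure :: "real measure \<Rightarrow> bool" where
  "fv_levy_measure \<nu> \<longleftrightarrow>
     sets \<nu> = sets borel \<and> emeasure \<nu> {0} = 0 \<and>
     (\<integral>\<^sup>+ x. ennreal (min 1 \<bar>x\<bar>) \<partial>\<nu>) < \<infinity>"

definition fv_exponent :: "real \<Rightarrow> real measure \<Rightarrow> real \<Rightarrow> complex" where
  "fv_exponent \<gamma> \<nu> u = \<i> * of_real (\<gamma> * u) + (CLINT x|\<nu>. iexp (u * x) - 1)"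

text \<open>\<open>fv_levy_process M L \<gamma> \<nu>\<close>: \<open>L\<close> is a Levy process of locally finite variation without
  Gaussian part, with drift \<open>\<gamma>\<close> and Levy measure \<open>\<nu>\<close>.\<close>

definition fv_levy_process ::
    "'a measure \<Rightarrow> (real \<Rightarrow> 'a \<Rightarrow> real) \<Rightarrow> real \<Rightarrow> real measure \<Rightarrow> bool" where
  "fv_levy_process M L \<gamma> \<nu> \<longleftrightarrow>
     levy_process M L \<and>
     (AE \<omega> in M. \<forall>T\<ge>0. bounded_variation_on {0..T} (\<lambda>t. L t \<omega>)) \<and>
     fv_levy_measure \<nu> \<and>
     (\<forall>t\<ge>0. \<forall>u. char (distr M borel (L t)) u = exp (of_real t * fv_exponent \<gamma> \<nu> u))"


section \<open>Compound Poisson, Gamma and self-decomposable processes\<close>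

definition poisson_process :: "'a measure \<Rightarrow> (real \<Rightarrow> 'a \<Rightarrow> nat) \<Rightarrow> real \<Rightarrow> bool" where
  "poisson_process M N c \<longleftrightarrow>
     levy_process M (\<lambda>t \<omega>. real (N t \<omega>)) \<and>
     (\<forall>t>0. distr M (count_space UNIV) (N t) = measure_pmf (poisson_pmf (c * t)))"

definition compound_poisson_process ::
    "'a measure \<Rightarrow> (real \<Rightarrow> 'a \<Rightarrow> real) \<Rightarrow> real \<Rightarrow> real measure \<Rightarrow> bool" where
  "compound_poisson_process M L c \<mu> \<longleftrightarrow>
     0 < c \<and>
     (\<exists>(N :: real \<Rightarrow> 'a \<Rightarrow> nat) (Y :: nat \<Rightarrow> 'a \<Rightarrow> real).
        poisson_process M N c \<and>
        prob_space.indep_vars M (\<lambda>_. borel) Y UNIV \<and>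
        (\<forall>k. distr M borel (Y k) = \<mu>) \<and>
        prob_space.indep_var M
          (PiM {0..} (\<lambda>_. borel)) (\<lambda>\<omega>. \<lambda>t\<in>{0..}. real (N t \<omega>))
          (PiM UNIV (\<lambda>_. borel)) (\<lambda>\<omega> k. Y k \<omega>) \<and>
        (\<forall>t\<ge>0. AE \<omega> in M. L t \<omega> = (\<Sum>k<N t \<omega>. Y k \<omega>)))"

definition gamma_density :: "real \<Rightarrow> real \<Rightarrow> real \<Rightarrow> real" where
  "gamma_density a l x =
     (if 0 < x then l powr a / Gamma a * x powr (a - 1) * exp (- l * x) else 0)"

definition gamma_process ::
    "'a measure \<Rightarrow> (real \<Rightarrow> 'a \<Rightarrow> real) \<Rightarrow> real \<Rightarrow> real \<Rightarrow> bool" where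
  "gamma_process M L \<alpha> l \<longleftrightarrow>
     0 < \<alpha> \<and> 0 < l \<and> levy_process M L \<and>
     (\<forall>t>0. distributed M lborel (L t) (\<lambda>x. ennreal (gamma_density (\<alpha> * t) l x)))"

text \<open>\<open>k_function \<nu> k p q\<close>: \<open>\<nu>(dx) = k(x) |x|\<^sup>-\<^sup>1 dx\<close> is the Levy measure of a self-decomposable
  process with \<open>k(0-) = p\<close> and \<open>k(0+) = q\<close>, both finite. The value \<open>k 0\<close> is immaterial.\<close>

definition k_function :: "real measure \<Rightarrow> (real \<Rightarrow> real) \<Rightarrow> real \<Rightarrow> real \<Rightarrow> bool" where
  "k_function \<nu> k p q \<longleftrightarrow>
     (\<forall>x. 0 \<le> k x) \<and> mono_on {..<0} k \<and> antimono_on {0<..} k \<and>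
     (k \<longlongrightarrow> p) (at_left 0) \<and> (k \<longlongrightarrow> q) (at_right 0) \<and>
     \<nu> = density lborel (\<lambda>x. ennreal (k x / \<bar>x\<bar>))"


section \<open>The admissible classes of processes\<close>

definition regular_compound_poisson :: "'a measure \<Rightarrow> (real \<Rightarrow> 'a \<Rightarrow> real) \<Rightarrow> bool" where
  "regular_compound_poisson M L \<longleftrightarrow>
     (\<exists>c f \<epsilon>. f \<in> borel_measurable borel \<and> (\<forall>x. 0 \<le> f x) \<and>
        compound_poisson_process M L c (density lborel (\<lambda>x. ennreal (f x))) \<and>
        bounded_variation_on UNIV (\<lambda>x. x * f x) \<and>
        0 < \<epsilon> \<and> (\<integral>\<^sup>+ x. ennreal (\<bar>x\<bar> powr (2 + \<epsilon>) * f x) \<partial>lborel) < \<infinity>)"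

text \<open>The last argument is the total activity \<open>k(0-) + k(0+)\<close> of the process at the origin.\<close>

definition regular_selfdecomposable :: "real measure \<Rightarrow> real \<Rightarrow> bool" where
  "regular_selfdecomposable \<nu> \<kappa> \<longleftrightarrow>
     (\<exists>k p q \<epsilon>. k_function \<nu> k p q \<and> \<kappa> = p + q \<and>
        0 < \<epsilon> \<and> (\<integral>\<^sup>+ x. ennreal (max 1 (\<bar>x\<bar> powr (1 + \<epsilon>)) * k x) \<partial>lborel) < \<infinity>)"

text \<open>A Gamma process is self-decomposable with \<open>k(x) = \<alpha> e\<^sup>-\<^sup>l\<^sup>x\<close> on the positive half-line, so
  that \<open>k(0-) + k(0+) = \<alpha>\<close>; a compound Poisson component does not contribute to the activity.\<close>

definition admissible_component ::
    "'a measure \<Rightarrow> (real \<Rightarrow> 'a \<Rightarrow> real) \<Rightarrow> real measure \<Rightarrow> real \<Rightarrow> bool" where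
  "admissible_component M L \<nu> \<kappa> \<longleftrightarrow>
     (regular_compound_poisson M L \<and> \<kappa> = 0) \<or>
     (\<exists>l. gamma_process M L \<kappa> l) \<or>
     regular_selfdecomposable \<nu> \<kappa>"

text \<open>\<open>L\<close> is the sum of finitely many independent admissible components. The bound
  \<open>1 / (2\<Delta>)\<close> is imposed on the total activity of the self-decomposable components (hence it also
  holds for each of them). Bounding each one separately would not be enough: the sum of two
  independent Gamma processes with \<open>\<alpha> = 2 / (5\<Delta>)\<close> and common \<open>l\<close> is a Gamma process with
  \<open>\<alpha> = 4 / (5\<Delta>)\<close>, whose inverse characteristic function grows like \<open>|u|\<^sup>4\<^sup>/\<^sup>5\<close>.\<close>

definition admissible_sum :: "'a measure \<Rightarrow> (real \<Rightarrow> 'a \<Rightarrow> real) \<Rightarrow> real \<Rightarrow> bool" where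
  "admissible_sum M L \<Delta> \<longleftrightarrow>
     (\<exists>(I :: nat set) X \<gamma> \<nu> \<kappa>. finite I \<and> I \<noteq> {} \<and>
        (\<forall>i\<in>I. fv_levy_process M (X i) (\<gamma> i) (\<nu> i) \<and>
                admissible_component M (X i) (\<nu> i) (\<kappa> i)) \<and>
        prob_space.indep_vars M (\<lambda>_. PiM {0..} (\<lambda>_. borel)) (\<lambda>i \<omega>. \<lambda>t\<in>{0..}. X i t \<omega>) I \<and>
        (\<Sum>i\<in>I. \<kappa> i) < 1 / (2 * \<Delta>) \<and>
        (\<forall>t\<ge>0. AE \<omega> in M. L t \<omega> = (\<Sum>i\<in>I. X i t \<omega>)))"


section \<open>The regularity condition\<close>

definition bounded_density_id :: "real measure \<Rightarrow> bool" where
  "bounded_density_id \<nu> \<longleftrightarrow>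
     integrable \<nu> (\<lambda>x. x) \<and>
     (\<exists>g. integrable lborel g \<and> (\<exists>B. \<forall>x. \<bar>g x\<bar> \<le> B) \<and>
        (\<forall>A\<in>sets borel. (LINT x:A|\<nu>. x) = (LINT x:A|lborel. g x)))"

definition fourier_id :: "real measure \<Rightarrow> real \<Rightarrow> complex" where
  "fourier_id \<nu> u = (CLINT x|\<nu>. of_real x * iexp (u * x))"

text \<open>\<open>bounded_density_id\<close> says that the signed measure \<open>x \<nu>(dx)\<close> is finite and has a bounded
  Lebesgue density; \<open>fourier_id\<close> is its Fourier transform.\<close>

definition condition_A :: "real measure \<Rightarrow> (real \<Rightarrow> complex) \<Rightarrow> bool" where
  "condition_A \<nu> \<phi> \<longleftrightarrow>
     (\<exists>\<epsilon>>0.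
        (\<integral>\<^sup>+ x. ennreal (max \<bar>x\<bar> (\<bar>x\<bar> powr (2 + \<epsilon>))) \<partial>\<nu>) < \<infinity> \<and>
        bounded_density_id \<nu> \<and>
        (\<exists>C. \<forall>u. cmod (fourier_id \<nu> u) \<le> C * (1 + \<bar>u\<bar>) powr (-1)) \<and>
        (\<lambda>u. of_real ((1 + \<bar>u\<bar>) powr (-1 + \<epsilon>)) * inverse (\<phi> u)) \<in> borel_measurable lborel \<and>
        integrable lborel
          (\<lambda>u. (cmod (of_real ((1 + \<bar>u\<bar>) powr (-1 + \<epsilon>)) * inverse (\<phi> u)))\<^sup>2))"

end

theory Submission
  imports Defs
begin

text \<open>In every case \<open>\<nu>(dx) = h(x) dx\<close>, where \<open>x h(x)\<close> is integrable and of bounded variation, which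
  makes its Fourier transform decay like \<open>1 / \<bar>u\<bar>\<close>. Moreover
  \<open>\<bar>\<phi>(u)\<bar> = exp (- \<Delta> \<integral> (1 - cos (u x)) h(x) dx)\<close>. A finite Levy measure contributes a bounded
  amount to the exponent; for \<open>h(x) = k(x) / \<bar>x\<bar>\<close> one compares \<open>k\<close> with \<open>k(0-)\<close> and \<open>k(0+)\<close> near the
  origin and gets at most \<open>(k(0-) + k(0+)) ln \<bar>u\<bar> + O(1)\<close>. So \<open>1 / \<phi>\<close> grows at most like \<open>\<bar>u\<bar>\<close> to the
  power \<open>\<Delta> \<kappa> < 1/2\<close>, \<open>\<kappa>\<close> being the total activity, and (c) follows. Where the process is given by
  its law rather than by \<open>\<nu>\<close>, the form of \<open>\<nu>\<close> comes from the uniqueness of the exponent and of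
  the Levy measure representing it.\<close>

section \<open>Functions of bounded variation\<close>

text \<open>What shapes the estimates is the threshold 1/2. Condition (c) asks for 2 (1 - \<epsilon>
  - \<Delta> \<kappa>) > 1, so the logarithm must come with the exact coefficient \<kappa>, while
  additive constants are harmless. Bounding 1 - cos by 2 in the integral of (1 - cos (u x)) / x
  would double the logarithm and reach only \<kappa> < 1 / (4 \<Delta>); hence the oscillation of
  the cosine has to be exploited. A single predicate on a density and an activity, closed under
  addition, carries all cases; (iv) then asks only that exponents of independent processes add. The
  other obstacle is that \<nu> is part of the data whereas (i), (ii) and (iv) speak of laws, and a
  complex logarithm of a characteristic function is ambiguous. Two ways around this are taken. For
  compound Poisson processes and for sums the law at time 1 is computed, and continuity in u selects
  the branch. For Gamma processes the exponent is the limit of (char - 1) / t as t tends to 0, taken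
  directly under the integral against the Gamma density.\<close>

lemma bounded_variation_on_monotone_bounded:
  assumes "mono f \<or> antimono f" "\<And>x. \<bar>f x\<bar> \<le> B"
  shows "bounded_variation_on UNIV f"
  unfolding bounded_variation_on_def
proof (intro exI[of _ "2 * B"] allI impI)
  fix n :: nat and t :: "nat \<Rightarrow> real"
  assume t: "\<forall>i<n. t i \<le> t (Suc i)"
  have "(\<Sum>i<n. \<bar>f (t (Suc i)) - f (t i)\<bar>) = \<bar>f (t n) - f (t 0)\<bar>"
    using assms(1)
  proof
    assume f: "mono f"
    have "(\<Sum>i<n. \<bar>f (t (Suc i)) - f (t i)\<bar>) = (\<Sum>i<n. f (t (Suc i)) - f (t i))"
      using t by (intro sum.cong refl abs_of_nonneg) (simp add: monoD[OF f])
    then have eq: "(\<Sum>i<n. \<bar>f (t (Suc i)) - f (t i)\<bar>) = f (t n) - f (t 0)"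
      using sum_lessThan_telescope[of "\<lambda>i. f (t i)" n] by simp
    moreover have "0 \<le> (\<Sum>i<n. \<bar>f (t (Suc i)) - f (t i)\<bar>)" by (simp add: sum_nonneg)
    ultimately show ?thesis by linarith
  next
    assume f: "antimono f"
    have "(\<Sum>i<n. \<bar>f (t (Suc i)) - f (t i)\<bar>) = (\<Sum>i<n. f (t i) - f (t (Suc i)))"
      using t by (intro sum.cong refl) (simp add: antimonoD[OF f])
    then have eq: "(\<Sum>i<n. \<bar>f (t (Suc i)) - f (t i)\<bar>) = f (t 0) - f (t n)"
      using sum_lessThan_telescope'[of "\<lambda>i. f (t i)" n] by simp
    moreover have "0 \<le> (\<Sum>i<n. \<bar>f (t (Suc i)) - f (t i)\<bar>)" by (simp add: sum_nonneg)
    ultimately show ?thesis by linarith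
  qed
  also have "\<dots> \<le> 2 * B" using assms(2)[of "t n"] assms(2)[of "t 0"] by linarith
  finally show "(\<Sum>i<n. \<bar>f (t (Suc i)) - f (t i)\<bar>) \<le> 2 * B" .
qed

lemma bounded_variation_on_add:
  assumes "bounded_variation_on S f" "bounded_variation_on S g"
  shows "bounded_variation_on S (\<lambda>x. f x + g x)"
proof -
  obtain B C where
    B: "\<And>n t. (\<forall>i\<le>(n::nat). t i \<in> S) \<Longrightarrow> (\<forall>i<n. t i \<le> t (Suc i)) \<Longrightarrow>
          (\<Sum>i<n. \<bar>f (t (Suc i)) - f (t i)\<bar>) \<le> B" and
    C: "\<And>n t. (\<forall>i\<le>(n::nat). t i \<in> S) \<Longrightarrow> (\<forall>i<n. t i \<le> t (Suc i)) \<Longrightarrow>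
          (\<Sum>i<n. \<bar>g (t (Suc i)) - g (t i)\<bar>) \<le> C"
    using assms unfolding bounded_variation_on_def by blast
  show ?thesis
    unfolding bounded_variation_on_def
  proof (intro exI[of _ "B + C"] allI impI)
    fix n :: nat and t :: "nat \<Rightarrow> real"
    assume t: "\<forall>i\<le>n. t i \<in> S" "\<forall>i<n. t i \<le> t (Suc i)"
    have "(\<Sum>i<n. \<bar>(f (t (Suc i)) + g (t (Suc i))) - (f (t i) + g (t i))\<bar>)
        \<le> (\<Sum>i<n. \<bar>f (t (Suc i)) - f (t i)\<bar> + \<bar>g (t (Suc i)) - g (t i)\<bar>)"
      by (intro sum_mono) linarith
    also have "\<dots> \<le> B + C"
      unfolding sum.distrib using B[OF t] C[OF t] by linarith
    finally show "(\<Sum>i<n. \<bar>(f (t (Suc i)) + g (t (Suc i))) - (f (t i) + g (t i))\<bar>) \<le> B + C" .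
  qed
qed

lemma bounded_variation_on_cmult:
  assumes "bounded_variation_on S f"
  shows "bounded_variation_on S (\<lambda>x. c * f x)"
proof -
  obtain B where
    B: "\<And>n t. (\<forall>i\<le>(n::nat). t i \<in> S) \<Longrightarrow> (\<forall>i<n. t i \<le> t (Suc i)) \<Longrightarrow>
          (\<Sum>i<n. \<bar>f (t (Suc i)) - f (t i)\<bar>) \<le> B"
    using assms unfolding bounded_variation_on_def by blast
  have "(\<Sum>i<n. \<bar>c * f (t (Suc i)) - c * f (t i)\<bar>) = \<bar>c\<bar> * (\<Sum>i<n. \<bar>f (t (Suc i)) - f (t i)\<bar>)"
    for n :: nat and t
    by (simp add: sum_distrib_left abs_mult flip: right_diff_distrib)
  then show ?thesis
    unfolding bounded_variation_on_def
    by (intro exI[of _ "\<bar>c\<bar> * B"]) (auto intro!: mult_left_mono B)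
qed

lemma bounded_variation_on_UNIV_bounded:
  assumes "bounded_variation_on UNIV f"
  obtains B where "\<And>x. \<bar>f x\<bar> \<le> B"
proof -
  obtain V where
    V: "\<And>n t. (\<forall>i<n. t i \<le> t (Suc i)) \<Longrightarrow> (\<Sum>i<(n::nat). \<bar>f (t (Suc i)) - f (t i)\<bar>) \<le> V"
    using assms unfolding bounded_variation_on_def by auto
  \<comment> \<open>The partition has a single interval, with endpoints 0 and \<open>x\<close> put
    in increasing order.\<close>
  have "\<bar>f x\<bar> \<le> \<bar>f 0\<bar> + V" for x
    using V[of 1 "\<lambda>i. if i = 0 then min 0 x else max 0 x"] by (cases "0 \<le> x") auto
  then show thesis by (rule that)
qed

text \<open>Cutting the line into pieces of length \<open>s\<close> and translating them all to \<open>[0, s)\<close> turns the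
  integral into the integral over \<open>[0, s)\<close> of a variation sum.\<close>

lemma nn_integral_bounded_variation_shift:
  fixes g :: "real \<Rightarrow> real"
  assumes V: "\<And>n t. (\<forall>i<n. t i \<le> t (Suc i)) \<Longrightarrow> (\<Sum>i<(n::nat). \<bar>g (t (Suc i)) - g (t i)\<bar>) \<le> V"
    and [measurable]: "g \<in> borel_measurable borel" and s: "0 < s"
  shows "(\<integral>\<^sup>+x. ennreal \<bar>g (x + s) - g x\<bar> \<partial>lborel) \<le> ennreal (s * V)"
proof -
  let ?d = "\<lambda>x. ennreal \<bar>g (x + s) - g x\<bar>"
  \<comment> \<open>A window of 2 N pieces of length \<open>s\<close>, indexed by naturals, hence
    the offset \<open>real i - real N\<close>. The bound is independent of N, so it survives the
    exhaustion of the line.\<close>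
  have window: "(\<integral>\<^sup>+x. ?d x * indicator {- (real N * s)..<real N * s} x \<partial>lborel) \<le> ennreal (s * V)"
    for N :: nat
  proof -
    have piece: "(\<integral>\<^sup>+x. ?d x * indicator {(real i - real N) * s..<(real i - real N + 1) * s} x \<partial>lborel)
        = (\<integral>\<^sup>+y. ?d ((real i - real N) * s + y) * indicator {0..<s} y \<partial>lborel)" for i :: nat
      by (subst nn_integral_real_affine[where c=1 and t="(real i - real N) * s"])
         (auto intro!: nn_integral_cong simp: indicator_def algebra_simps)
    have cover: "indicator {- (real N * s)..<real N * s} x
        \<le> (\<Sum>i<2 * N. indicator {(real i - real N) * s..<(real i - real N + 1) * s} x :: ennreal)" for x
    proof (cases "x \<in> {- (real N * s)..<real N * s}")
      case True
      define j where "j = \<lfloor>x / s\<rfloor>"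
      have j: "of_int j * s \<le> x" "x < (of_int j + 1) * s"
        using s by (simp_all add: j_def floor_divide_lower floor_divide_upper)
      have "- real N * s < (of_int j + 1) * s" using True j by auto
      then have "- real N < of_int j + 1" using s by (simp only: mult_less_cancel_right_pos)
      then have j1: "- int N \<le> j" by linarith
      have "of_int j * s < real N * s" using True j by auto
      then have "of_int j < real N" using s by (simp only: mult_less_cancel_right_pos)
      then have j2: "j < int N" by linarith
      define i where "i = nat (j + int N)"
      have i: "i < 2 * N" "real i - real N = of_int j" using j1 j2 by (auto simp: i_def)
      have "1 = (indicator {(real i - real N) * s..<(real i - real N + 1) * s} x :: ennreal)"
        using j i(2) by (simp add: indicator_def)
      also have "\<dots> \<le> (\<Sum>i<2 * N. indicator {(real i - real N) * s..<(real i - real N + 1) * s} x)"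
        using i(1) by (intro member_le_sum) auto
      finally show ?thesis using True by simp
    qed simp
    have "(\<integral>\<^sup>+x. ?d x * indicator {- (real N * s)..<real N * s} x \<partial>lborel)
        \<le> (\<integral>\<^sup>+x. (\<Sum>i<2 * N. ?d x * indicator {(real i - real N) * s..<(real i - real N + 1) * s} x)
             \<partial>lborel)"
      using cover by (intro nn_integral_mono) (auto simp flip: sum_distrib_left intro!: mult_left_mono)
    also have "\<dots> = (\<Sum>i<2 * N. \<integral>\<^sup>+y. ?d ((real i - real N) * s + y) * indicator {0..<s} y \<partial>lborel)"
      unfolding piece[symmetric] by (rule nn_integral_sum) simp
    also have "\<dots> = (\<integral>\<^sup>+y. (\<Sum>i<2 * N. ?d ((real i - real N) * s + y) * indicator {0..<s} y) \<partial>lborel)"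
      by (rule nn_integral_sum[symmetric]) simp
    also have "\<dots> \<le> (\<integral>\<^sup>+y. ennreal V * indicator {0..<s} y \<partial>lborel)"
    proof (intro nn_integral_mono)
      fix y
      let ?t = "\<lambda>i. (real i - real N) * s + y"
      have "(\<Sum>i<2 * N. \<bar>g (?t i + s) - g (?t i)\<bar>) = (\<Sum>i<2 * N. \<bar>g (?t (Suc i)) - g (?t i)\<bar>)"
        by (simp add: algebra_simps)
      also have "\<dots> \<le> V" using s by (intro V) (simp add: algebra_simps)
      finally have "(\<Sum>i<2 * N. ?d (?t i)) \<le> ennreal V" by (simp add: ennreal_leI)
      then show "(\<Sum>i<2 * N. ?d (?t i) * indicator {0..<s} y) \<le> ennreal V * indicator {0..<s} y"
        unfolding sum_distrib_right[symmetric] by (intro mult_right_mono) auto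
    qed
    also have "\<dots> = ennreal (s * V)"
      using s V[of 0] by (simp add: nn_integral_cmult_indicator ennreal_mult' mult.commute)
    finally show ?thesis .
  qed
  have "(\<integral>\<^sup>+x. ?d x \<partial>lborel)
      = (\<integral>\<^sup>+x. (SUP N. ?d x * indicator {- (real N * s)..<real N * s} x) \<partial>lborel)"
  proof (intro nn_integral_cong)
    fix x
    obtain N :: nat where N: "\<bar>x\<bar> / s < N" using reals_Archimedean2 by blast
    then have "x \<in> {- (real N * s)..<real N * s}" using s by (auto simp: field_simps)
    then have "?d x \<le> (SUP N. ?d x * indicator {- (real N * s)..<real N * s} x)"
      by (intro SUP_upper2[of N]) auto
    then show "?d x = (SUP N. ?d x * indicator {- (real N * s)..<real N * s} x)"
      by (intro antisym SUP_least) (auto simp: indicator_def)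
  qed
  also have "\<dots> = (SUP N. \<integral>\<^sup>+x. ?d x * indicator {- (real N * s)..<real N * s} x \<partial>lborel)"
  proof (rule nn_integral_monotone_convergence_SUP)
    show "incseq (\<lambda>N x. ?d x * indicator {- (real N * s)..<real N * s} x)"
    proof (intro monoI le_funI mult_left_mono)
      fix N N' :: nat and x assume "N \<le> N'"
      then have "real N * s \<le> real N' * s" using s by (intro mult_right_mono) auto
      then show "(indicator {- (real N * s)..<real N * s} x :: ennreal)
        \<le> indicator {- (real N' * s)..<real N' * s} x" by (auto simp: indicator_def)
    qed simp
  qed simp
  also have "\<dots> \<le> ennreal (s * V)" by (intro SUP_least window)
  finally show ?thesis .
qed

text \<open>Translating by half a period, \<open>s = pi / u\<close>, flips the sign of
  \<open>iexp (u * x)\<close>. So twice the transform is the transform of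
  \<open>g x - g (s + x)\<close>, whose L1 norm is at most \<open>\<bar>s\<bar> * V\<close>. The
  shift plays the part of an integration by parts; the L1 norm of \<open>g\<close> takes care of
  small \<open>u\<close>.\<close>

lemma fourier_bounded_variation_decay:
  fixes g :: "real \<Rightarrow> real"
  assumes bv: "bounded_variation_on UNIV g" and g: "integrable lborel g"
  obtains C where "\<And>u. cmod (CLINT x|lborel. of_real (g x) * iexp (u * x)) \<le> C * (1 + \<bar>u\<bar>) powr (-1)"
proof -
  obtain V where
    V: "\<And>n t. (\<forall>i<n. t i \<le> t (Suc i)) \<Longrightarrow> (\<Sum>i<(n::nat). \<bar>g (t (Suc i)) - g (t i)\<bar>) \<le> V"
    using bv unfolding bounded_variation_on_def by auto
  have V0: "0 \<le> V" using V[of 0] by simp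
  have [measurable]: "g \<in> borel_measurable borel" using g by auto
  have shift_le: "(\<integral>\<^sup>+x. ennreal \<bar>g (x + r) - g x\<bar> \<partial>lborel) \<le> ennreal (r * V)" if "0 < r" for r
    by (rule nn_integral_bounded_variation_shift[where g=g and V=V]) (use V that in auto)
  let ?F = "\<lambda>u. CLINT x|lborel. of_real (g x) * iexp (u * x)"
  have int: "integrable lborel (\<lambda>x. of_real (g x) * iexp (u * x))" for u
    by (rule Bochner_Integration.integrable_bound[OF g]) (auto simp: norm_mult)
  define I where "I = (\<integral>x. \<bar>g x\<bar> \<partial>lborel)"
  have I: "cmod (?F u) \<le> I" for u
    using integral_norm_bound[of lborel "\<lambda>x. of_real (g x) * iexp (u * x)"] by (simp add: I_def norm_mult)
  have decay: "\<bar>u\<bar> * cmod (?F u) \<le> pi * V / 2" if "u \<noteq> 0" for u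
  proof -
    define s where "s = pi / u"
    have us: "u * s = pi" using that by (simp add: s_def)
    have shift: "?F u = - (CLINT x|lborel. of_real (g (s + x)) * iexp (u * x))"
    proof -
      have "?F u = (CLINT x|lborel. of_real (g (s + 1 * x)) * iexp (u * (s + 1 * x)))"
        by (subst lborel_integral_real_affine[where c=1 and t=s]) auto
      also have "\<dots> = (CLINT x|lborel. - (of_real (g (s + x)) * iexp (u * x)))"
      proof (intro Bochner_Integration.integral_cong refl)
        fix x
        have "\<i> * complex_of_real (u * (s + 1 * x)) = \<i> * of_real pi + \<i> * of_real (u * x)"
          using us by (simp add: algebra_simps flip: of_real_mult)
        then have "iexp (u * (s + 1 * x)) = - iexp (u * x)"
          by (simp add: exp_add mult.commute[of \<i>])
        then show "of_real (g (s + 1 * x)) * iexp (u * (s + 1 * x)) = - (of_real (g (s + x)) * iexp (u * x))"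
          by simp
      qed
      finally show ?thesis by simp
    qed
    have ints: "integrable lborel (\<lambda>x. of_real (g (s + x)) * iexp (u * x))"
      by (rule Bochner_Integration.integrable_bound[OF lborel_integrable_real_affine[OF g, of 1 s]])
         (auto simp: norm_mult)
    have "2 * ?F u = ?F u - (CLINT x|lborel. of_real (g (s + x)) * iexp (u * x))"
      using shift by simp
    also have "\<dots> = (CLINT x|lborel. of_real (g x - g (s + x)) * iexp (u * x))"
      unfolding of_real_diff left_diff_distrib
      by (rule Bochner_Integration.integral_diff[OF int ints, symmetric])
    finally have F: "2 * ?F u = (CLINT x|lborel. of_real (g x - g (s + x)) * iexp (u * x))" .
    have "2 * cmod (?F u) = cmod (CLINT x|lborel. of_real (g x - g (s + x)) * iexp (u * x))"
      unfolding F[symmetric] by (simp only: norm_mult norm_numeral)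
    also have "ennreal \<dots> \<le> (\<integral>\<^sup>+x. ennreal \<bar>g x - g (s + x)\<bar> \<partial>lborel)"
    proof (rule order_trans[OF integral_norm_bound_ennreal])
      show "complex_integrable lborel (\<lambda>x. of_real (g x - g (s + x)) * iexp (u * x))"
        unfolding of_real_diff left_diff_distrib
      by (rule Bochner_Integration.integrable_diff[OF int ints])
    qed (simp add: norm_mult flip: of_real_diff)
    also have "\<dots> \<le> ennreal (\<bar>s\<bar> * V)"
    proof (cases "0 < s")
      case True
      then show ?thesis
        using shift_le[OF True]
        by (simp add: abs_minus_commute add.commute)
    next
      \<comment> \<open>A negative \<open>u\<close> makes \<open>s\<close> negative. The
        substitution exchanges the two arguments and leaves a shift by the positive number
        \<open>- s\<close>.\<close>
      case False
      then have "0 < - s" using that by (auto simp: s_def divide_less_0_iff zero_less_divide_iff)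
      have "(\<integral>\<^sup>+x. ennreal \<bar>g x - g (s + x)\<bar> \<partial>lborel) = (\<integral>\<^sup>+x. ennreal \<bar>g (x + - s) - g x\<bar> \<partial>lborel)"
        by (subst nn_integral_real_affine[where c=1 and t="- s"]) auto
      then show ?thesis
        using shift_le[OF \<open>0 < - s\<close>] \<open>0 < - s\<close> by simp
    qed
    finally have "2 * cmod (?F u) \<le> \<bar>s\<bar> * V"
      using V0 by (subst (asm) ennreal_le_iff) auto
    then have "\<bar>u\<bar> * (2 * cmod (?F u)) \<le> \<bar>u\<bar> * (\<bar>s\<bar> * V)" by (intro mult_left_mono) auto
    also have "\<dots> = pi * V" using us by (simp flip: mult.assoc abs_mult)
    finally show ?thesis by simp
  qed
  show thesis
  proof (rule that)
    fix u :: real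
    have "(1 + \<bar>u\<bar>) * cmod (?F u) \<le> I + pi * V / 2"
      using decay[of u] I[of u] V0 by (cases "u = 0") (auto simp: distrib_right intro: add_increasing2)
    then show "cmod (?F u) \<le> (I + pi * V / 2) * (1 + \<bar>u\<bar>) powr (-1)"
      by (simp add: powr_minus field_simps)
  qed
qed

section \<open>Two integral estimates\<close>

lemma one_minus_cos_le: "1 - cos (x::real) \<le> x\<^sup>2 / 2"
proof -
  have "1 - cos x = 2 * (sin (x / 2))\<^sup>2" using cos_double_sin[of "x / 2"] by simp
  also have "\<dots> \<le> 2 * (x / 2)\<^sup>2"
    using abs_sin_x_le_abs_x[of "x / 2"] by (intro mult_left_mono) (auto simp flip: abs_le_square_iff)
  finally show ?thesis by (simp add: power2_eq_square)
qed

text \<open>The coefficient 1 of the logarithm is what matters, since it ends up in the growth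
  exponent of 1 / \<phi>. With v = \<bar>u\<bar> > 1, the quadratic bound on 1 - cos gives O(1) up
  to 1 / v; from 1 / v to 1 the term 1 / x yields ln v and the cosine part stays bounded.\<close>

lemma nn_integral_one_minus_cos_over_x:
  "(\<integral>\<^sup>+x. ennreal ((1 - cos (u * x)) / x * indicator {0<..1} x) \<partial>lborel) \<le> ennreal (ln (1 + \<bar>u\<bar>) + 4)"
proof -
  define v where "v = \<bar>u\<bar>"
  have cos_v: "cos (u * x) = cos (v * x)" for x by (simp add: v_def abs_if)
  have near: "(1 - cos (v * x)) / x \<le> v\<^sup>2 / 2 * x" if "0 < x" for x
    using one_minus_cos_le[of "v * x"] that by (simp add: field_simps power2_eq_square)
  show ?thesis
  proof (cases "v \<le> 1")
    case True
    have "(\<integral>\<^sup>+x. ennreal ((1 - cos (u * x)) / x * indicator {0<..1} x) \<partial>lborel)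
        \<le> (\<integral>\<^sup>+x. ennreal 1 * indicator {0..1::real} x \<partial>lborel)"
    proof (intro nn_integral_mono)
      fix x
      have "(1 - cos (v * x)) / x \<le> 1" if "x \<in> {0<..1}"
      proof -
        have "v\<^sup>2 \<le> 1" using True by (simp add: v_def abs_square_le_1)
        then have "v\<^sup>2 * x \<le> 1 * 1" using that by (intro mult_mono) auto
        then have "v\<^sup>2 / 2 * x \<le> 1" by simp
        then show ?thesis using that by (meson greaterThanAtMost_iff near order_trans)
      qed
      then show "ennreal ((1 - cos (u * x)) / x * indicator {0<..1} x) \<le> ennreal 1 * indicator {0..1} x"
        by (auto simp: cos_v indicator_def ennreal_leI)
    qed
    also have "\<dots> = ennreal 1" by simp
    also have "\<dots> \<le> ennreal (ln (1 + \<bar>u\<bar>) + 4)" by (intro ennreal_leI) (simp add: add_increasing)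
    finally show ?thesis .
  next
    case False
    then have v: "1 < v" by simp
    \<comment> \<open>\<open>h\<close> exceeds the integrand by the second summand, which cancels the non-elementary part of
      its antiderivative.\<close>
    define H where "H = (\<lambda>x. ln x - sin (v * x) / (v * x) - 1 / (v * x))"
    define h where "h = (\<lambda>x. (1 - cos (v * x)) / x + (1 + sin (v * x)) / (v * x\<^sup>2))"
    have [measurable]: "h \<in> borel_measurable borel" by (simp add: h_def)
    have H: "(H has_real_derivative h x) (at x)" if "1 / v \<le> x" for x
    proof -
      have x: "0 < x" using that v by (smt (verit) divide_pos_pos)
      show ?thesis
        unfolding H_def h_def using x v
        by (auto intro!: derivative_eq_intros simp: field_simps power2_eq_square)
    qed
    \<comment> \<open>The 1 beside the sine, which stems from \<open>- 1 / (v * x)\<close> in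
      \<open>H\<close>, makes the extra summand nonnegative; it adds at most 1 to the integral over
      [1 / v, 1].\<close>
    have h: "0 \<le> h x" "(1 - cos (v * x)) / x \<le> h x" if "0 < x" for x
    proof -
      have "0 \<le> (1 + sin (v * x)) / (v * x\<^sup>2)"
        using sin_ge_minus_one[of "v * x"] v that
        by (intro divide_nonneg_nonneg mult_nonneg_nonneg zero_le_power2) linarith+
      moreover have "0 \<le> (1 - cos (v * x)) / x" using that by simp
      ultimately show "0 \<le> h x" "(1 - cos (v * x)) / x \<le> h x" by (auto simp: h_def)
    qed
    have "(\<integral>\<^sup>+x. ennreal ((1 - cos (u * x)) / x * indicator {0<..1} x) \<partial>lborel)
        \<le> (\<integral>\<^sup>+x. ennreal (v / 2) * indicator {0..1 / v} x + ennreal (h x) * indicator {1 / v..1} x \<partial>lborel)"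
    proof (intro nn_integral_mono)
      fix x
      show "ennreal ((1 - cos (u * x)) / x * indicator {0<..1} x)
          \<le> ennreal (v / 2) * indicator {0..1 / v} x + ennreal (h x) * indicator {1 / v..1} x"
      proof (cases "x \<in> {0<..1}")
        case True
        show ?thesis
        proof (cases "x \<le> 1 / v")
          case le: True
          have "v * x \<le> 1" using le v by (simp add: field_simps)
          then have "v / 2 * (v * x) \<le> v / 2 * 1" using v by (intro mult_left_mono) auto
          then have "(1 - cos (v * x)) / x \<le> v / 2"
            using near[of x] True by (auto simp: power2_eq_square mult_ac)
          then show ?thesis
            using True le by (simp add: cos_v ennreal_leI add_increasing2)
        next
          case False
          then show ?thesis using True h(2)[of x] by (auto simp: cos_v ennreal_leI)
        qed
      qed simp
    qed
    also have "\<dots> = (\<integral>\<^sup>+x. ennreal (v / 2) * indicator {0..1 / v} x \<partial>lborel)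
        + (\<integral>\<^sup>+x. ennreal (h x) * indicator {1 / v..1} x \<partial>lborel)"
      by (rule nn_integral_add) auto
    also have "(\<integral>\<^sup>+x. ennreal (v / 2) * indicator {0..1 / v} x \<partial>lborel) = ennreal (1 / 2)"
      using v by (simp add: nn_integral_cmult_indicator flip: ennreal_mult)
    also have "(\<integral>\<^sup>+x. ennreal (h x) * indicator {1 / v..1} x \<partial>lborel) = ennreal (H 1 - H (1 / v))"
    proof (rule nn_integral_FTC_Icc)
      fix x assume "x \<in> {1 / v..1}"
      then have x: "1 / v \<le> x" by simp
      then have "0 < x" using v by (smt (verit) divide_pos_pos)
      then show "0 \<le> h x" by (rule h)
      show "(H has_real_derivative h x) (at x)" by (rule H[OF x])
    qed (use v in auto)
    also have "ennreal (1 / 2) + ennreal (H 1 - H (1 / v)) = ennreal (1 / 2 + (H 1 - H (1 / v)))"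
    proof (rule ennreal_plus[symmetric])
      have "H (1 / v) \<le> H 1"
      proof (rule DERIV_nonneg_imp_nondecreasing[of "1 / v" 1 H])
 fix x assume x: "1 / v \<le> x" "x \<le> 1"
        then have "0 < x" using v by (smt (verit) divide_pos_pos)
        then show "\<exists>y. (H has_real_derivative y) (at x) \<and> 0 \<le> y" using H[OF x(1)] h(1) by blast
      qed (use v in auto)
      then show "0 \<le> H 1 - H (1 / v)" by simp
    qed simp
    also have "\<dots> \<le> ennreal (ln (1 + \<bar>u\<bar>) + 4)"
    proof (rule ennreal_leI)
      \<comment> \<open>The terms \<open>- sin v / v\<close> and \<open>- 1 / v\<close> add up to at
        most 0, so the total stays below ln v + 5/2; the 4 is a generous round number.\<close>
      have "H 1 - H (1 / v) = ln v - sin v / v - 1 / v + sin 1 + 1"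
        using v by (simp add: H_def ln_div)
      moreover have "- sin v / v \<le> 1 / v"
        using v sin_ge_minus_one[of v] by (intro divide_right_mono) auto
      moreover have "ln v \<le> ln (1 + v)" using v by simp
      moreover have "sin 1 \<le> (1::real)" by simp
      ultimately show "1 / 2 + (H 1 - H (1 / v)) \<le> ln (1 + \<bar>u\<bar>) + 4"
        unfolding v_def[symmetric] by linarith
    qed
    finally show ?thesis .
  qed
qed

lemma integrable_one_plus_abs_powr:
  assumes "1 < s"
  shows "integrable lborel (\<lambda>u::real. (1 + \<bar>u\<bar>) powr (- s))"
proof -
  let ?f = "\<lambda>x::real. (1 + \<bar>x\<bar>) powr (- s)"
  have half: "(\<integral>\<^sup>+x. ennreal (?f x) * indicator {0..} x \<partial>lborel) < \<infinity>"
  proof -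
    have "(\<integral>\<^sup>+x. ennreal (?f x) * indicator {0..} x \<partial>lborel)
        = ennreal (0 - - 1 / (s - 1) * (1 + 0) powr (1 - s))"
    proof -
      have "(\<integral>\<^sup>+x. ennreal (?f x) * indicator {0..} x \<partial>lborel)
          = (\<integral>\<^sup>+x. ennreal ((1 + x) powr (- s)) * indicator {0..} x \<partial>lborel)"
        by (intro nn_integral_cong) (auto simp: indicator_def)
      also have "\<dots> = ennreal (0 - - 1 / (s - 1) * (1 + 0) powr (1 - s))"
      proof (rule nn_integral_FTC_atLeast)
        fix x :: real assume "0 \<le> x"
        then have "((\<lambda>x. - 1 / (s - 1) * (1 + x) powr (1 - s)) has_real_derivative
            - 1 / (s - 1) * ((1 - s) * (1 + x) powr (1 - s - 1) * 1)) (at x)"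
          by (intro DERIV_cmult DERIV_fun_powr) (auto intro!: derivative_eq_intros)
        moreover have "- 1 / (s - 1) * ((1 - s) * (1 + x) powr (1 - s - 1) * 1) = (1 + x) powr (- s)"
          using assms by (simp add: field_simps)
        ultimately show "((\<lambda>x. - 1 / (s - 1) * (1 + x) powr (1 - s)) has_real_derivative
            (1 + x) powr (- s)) (at x)"
          by simp
      next
        have "((\<lambda>x. (1 + x) powr (1 - s)) \<longlongrightarrow> 0) at_top"
          using assms
          by (intro tendsto_neg_powr filterlim_tendsto_add_at_top[OF tendsto_const])
             (auto simp: filterlim_ident)
        then show "((\<lambda>x. - 1 / (s - 1) * (1 + x) powr (1 - s)) \<longlongrightarrow> 0) at_top"
          by (rule tendsto_mult_right_zero)
      qed auto
      finally show ?thesis .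
    qed
    then show ?thesis by (simp add: ennreal_less_top)
  qed
  have "(\<integral>\<^sup>+x. ennreal (?f x) * indicator {..0} x \<partial>lborel) = (\<integral>\<^sup>+x. ennreal (?f x) * indicator {0..} x \<partial>lborel)"
    by (subst nn_integral_real_affine[where c="-1" and t=0])
       (auto intro!: nn_integral_cong simp: indicator_def)
  moreover have "(\<integral>\<^sup>+x. ennreal (?f x) \<partial>lborel)
      \<le> (\<integral>\<^sup>+x. ennreal (?f x) * indicator {0..} x + ennreal (?f x) * indicator {..0} x \<partial>lborel)"
    by (intro nn_integral_mono) (auto simp: indicator_def)
  ultimately have "(\<integral>\<^sup>+x. ennreal (?f x) \<partial>lborel) < \<infinity>"
    using half by (auto simp: nn_integral_add elim!: order.strict_trans1)
  then show ?thesis by (intro integrableI_bounded) auto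
qed

section \<open>Uniqueness of the Levy measure\<close>

text \<open>The transform at 0 is the total mass, so the masses agree and the same factor
  \<open>1 / c\<close> turns both measures into probability measures, which are determined by their
  characteristic functions. Zero mass is separate because it cannot be normalised.\<close>

lemma finite_borel_measure_eqI_fourier:
  fixes \<mu> \<mu>' :: "real measure"
  assumes "finite_measure \<mu>" "finite_measure \<mu>'" and sets: "sets \<mu> = sets borel" "sets \<mu>' = sets borel"
    and eq: "\<And>u. (CLINT x|\<mu>. iexp (u * x)) = (CLINT x|\<mu>'. iexp (u * x))"
  shows "\<mu> = \<mu>'"
proof -
  interpret \<mu>: finite_measure \<mu> by fact
  interpret \<mu>': finite_measure \<mu>' by fact
  have sp: "space \<mu> = UNIV" "space \<mu>' = UNIV" using sets[THEN sets_eq_imp_space_eq] by auto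
  define c where "c = measure \<mu> UNIV"
  have "complex_of_real (measure \<mu> UNIV) = complex_of_real (measure \<mu>' UNIV)"
    using eq[of 0] by (simp add: sp)
  then have c': "measure \<mu>' UNIV = c" by (simp add: c_def)
  show ?thesis
  proof (cases "c = 0")
    case True
    show ?thesis
    proof (rule measure_eqI)
      fix A
      have "measure \<mu> A \<le> c" "measure \<mu>' A \<le> c"
        using \<mu>.bounded_measure[of A] \<mu>'.bounded_measure[of A] c' by (simp_all add: sp c_def)
      then show "emeasure \<mu> A = emeasure \<mu>' A"
        using True by (simp add: \<mu>.emeasure_eq_measure \<mu>'.emeasure_eq_measure measure_le_0_iff)
    qed (simp add: sets)
  next
    case False
    then have c: "0 < c" by (simp add: c_def measure_nonneg order.not_eq_order_implies_strict)
    have dist: "real_distribution (scale_measure (ennreal (1 / c)) m)"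
      and char: "char (scale_measure (ennreal (1 / c)) m) u = of_real (1 / c) * (CLINT x|m. iexp (u * x))"
      if "finite_measure m" "sets m = sets borel" "measure m UNIV = c" for m :: "real measure" and u
    proof -
      interpret m: finite_measure m by fact
      have spm: "space m = UNIV" using that(2)[THEN sets_eq_imp_space_eq] by simp
      have [measurable_cong]: "sets m = sets borel" by fact
      show "real_distribution (scale_measure (ennreal (1 / c)) m)"
      proof -
        have "prob_space (scale_measure (ennreal (1 / c)) m)"
          using c that(3) by (intro prob_spaceI)
            (simp add: space_scale_measure spm m.emeasure_eq_measure flip: ennreal_mult)
        then show ?thesis
          by (simp add: real_distribution_def real_distribution_axioms_def space_scale_measure spm that(2))
      qed
      have "scale_measure (ennreal (1 / c)) m = density m (\<lambda>x. ennreal (1 / c))"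
        by (rule measure_eqI) (simp_all add: emeasure_density nn_integral_cmult_indicator)
      then show "char (scale_measure (ennreal (1 / c)) m) u = of_real (1 / c) * (CLINT x|m. iexp (u * x))"
        using c unfolding char_def
        by (subst \<open>scale_measure _ m = _\<close>, subst integral_density) (auto simp: scaleR_conv_of_real)
    qed
    have "scale_measure (ennreal (1 / c)) \<mu> = scale_measure (ennreal (1 / c)) \<mu>'"
    proof (intro Levy_uniqueness dist ext)
      fix u
      show "char (scale_measure (ennreal (1 / c)) \<mu>) u = char (scale_measure (ennreal (1 / c)) \<mu>') u"
        using char[OF assms(1) sets(1) c_def[symmetric]] char[OF assms(2) sets(2) c'] eq by simp
    qed (use assms(1,2) sets c' in \<open>simp_all add: c_def\<close>)
    then have "scale_measure (ennreal c) (scale_measure (ennreal (1 / c)) \<mu>)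
        = scale_measure (ennreal c) (scale_measure (ennreal (1 / c)) \<mu>')" by simp
    then show ?thesis using c by (simp flip: ennreal_mult)
  qed
qed

text \<open>The factor \<open>min 1 \<bar>x\<bar>\<close> is what a Levy measure of finite variation
  integrates. The constant is locally bounded in \<open>u\<close>, which later provides the
  domination for continuity of the exponent.\<close>

lemma cmod_iexp_minus_1_le: "cmod (iexp (u * x) - 1) \<le> (2 + \<bar>u\<bar>) * min 1 \<bar>x\<bar>"
proof (cases "\<bar>x\<bar> \<le> 1")
  case True
  have "cmod (iexp (u * x) - 1) \<le> \<bar>u * x\<bar>" using iexp_approx1[of "u * x" 0] by simp
  also have "\<dots> \<le> (2 + \<bar>u\<bar>) * \<bar>x\<bar>" unfolding abs_mult by (intro mult_right_mono) auto
  finally show ?thesis using True by (simp add: min_def)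
next
  case False
  have "cmod (iexp (u * x) - 1) \<le> cmod (iexp (u * x)) + cmod 1" by (rule norm_triangle_ineq4)
  also have "\<dots> \<le> 2 + \<bar>u\<bar>" by simp
  finally show ?thesis using False by (simp add: min_def)
qed

lemma fv_levy_measure_integrable:
  assumes "fv_levy_measure \<nu>"
  shows "integrable \<nu> (\<lambda>x. min 1 \<bar>x\<bar>)" and "complex_integrable \<nu> (\<lambda>x. iexp (u * x) - 1)"
proof -
  have [measurable_cong]: "sets \<nu> = sets borel" using assms by (simp add: fv_levy_measure_def)
  show min: "integrable \<nu> (\<lambda>x. min 1 \<bar>x\<bar>)"
    using assms by (intro integrableI_bounded) (auto simp: fv_levy_measure_def)
  show "complex_integrable \<nu> (\<lambda>x. iexp (u * x) - 1)"
    by (rule Bochner_Integration.integrable_bound[OF integrable_mult_right[OF min, of "2 + \<bar>u\<bar>"]])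
       (use cmod_iexp_minus_1_le[of u] in \<open>auto simp: abs_mult\<close>)
qed

text \<open>If both cosines are 1, then \<open>x\<close> and \<open>sqrt 2 * x\<close> are integer
  multiples of 2 pi, which for nonzero \<open>x\<close> contradicts the irrationality of
  \<open>sqrt 2\<close>. A single 1 - cos x would vanish on a whole lattice, where a Levy measure
  may have atoms.\<close>

lemma two_minus_cos_cos_sqrt2_pos:
  assumes "x \<noteq> 0"
  shows "0 < 2 - cos x - cos (sqrt 2 * x)"
proof (rule ccontr)
  assume "\<not> ?thesis"
  then have "cos x = 1" "cos (sqrt 2 * x) = 1"
    using cos_le_one[of x] cos_le_one[of "sqrt 2 * x"] by linarith+
  then obtain m n :: int where x: "x = of_int m * 2 * pi" and "sqrt 2 * x = of_int n * 2 * pi"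
    unfolding cos_one_2pi_int by blast
  then have "(sqrt 2 * of_int m)\<^sup>2 = (of_int n :: real)\<^sup>2" by simp
  then have "of_int (2 * m\<^sup>2) = (of_int (n\<^sup>2) :: real)" by (simp add: power_mult_distrib)
  then have eq: "2 * m\<^sup>2 = n\<^sup>2" by (simp only: of_int_eq_iff)
  have m: "m \<noteq> 0" using x assms by auto
  then have n: "n \<noteq> 0" using eq by auto
  \<comment> \<open>The exponent of 2 is odd in \<open>2 * m\<^sup>2\<close> and even in
    \<open>n\<^sup>2\<close>.\<close>
  have "multiplicity 2 (2 * m\<^sup>2) = 1 + 2 * multiplicity 2 m"
    using m by (simp add: prime_elem_multiplicity_mult_distrib prime_elem_multiplicity_power_distrib)
  moreover have "multiplicity 2 (n\<^sup>2) = 2 * multiplicity 2 n"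
    using n by (simp add: prime_elem_multiplicity_power_distrib)
  ultimately have "1 + 2 * multiplicity 2 m = 2 * multiplicity 2 n" using eq by simp
  then show False by presburger
qed

text \<open>The second differences \<open>\<psi>(u) - (\<psi>(u + h) + \<psi>(u - h)) / 2\<close> remove the drift and are the
  Fourier transform of the finite measure \<open>(1 - cos (h x)) \<nu>(dx)\<close>. Adding those for \<open>h = 1\<close> and
  \<open>h = sqrt 2\<close> makes the density vanish at \<open>0\<close> only.\<close>

lemma fv_exponent_unique:
  assumes \<nu>: "fv_levy_measure \<nu>" and \<nu>': "fv_levy_measure \<nu>'"
    and eq: "\<And>u. fv_exponent \<gamma> \<nu> u = fv_exponent \<gamma>' \<nu>' u"
  shows "\<nu> = \<nu>'"
proof -
  define w where "w = (\<lambda>x::real. 2 - cos x - cos (sqrt 2 * x))"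
  have [measurable]: "w \<in> borel_measurable borel" by (simp add: w_def)
  have w0: "0 \<le> w x" for x
    using cos_le_one[of x] cos_le_one[of "sqrt 2 * x"] unfolding w_def by linarith
  have w_pos: "0 < w x" if "x \<noteq> 0" for x
    using two_minus_cos_cos_sqrt2_pos[OF that] by (simp add: w_def)
  let ?D = "\<lambda>\<psi> h u. \<psi> u - (\<psi> (u + h) + \<psi> (u - h)) / (2::complex)"
  have fin: "finite_measure (density m (\<lambda>x. ennreal (w x)))"
    and fourier: "(CLINT x|density m (\<lambda>x. ennreal (w x)). iexp (u * x))
        = ?D (fv_exponent g m) 1 u + ?D (fv_exponent g m) (sqrt 2) u"
    if m: "fv_levy_measure m" for m g u
  proof -
    have [measurable_cong]: "sets m = sets borel" using m by (simp add: fv_levy_measure_def)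
    let ?e = "\<lambda>u x. iexp (u * x) - 1"
    \<comment> \<open>The constants -1 cancel in the second difference, since 1 - (1 + 1) / 2 =
      0.\<close>
    have D: "?D (\<lambda>v. ?e v x) h u = of_real (1 - cos (h * x)) * iexp (u * x)" for h x u
    proof -
      have "iexp ((u + h) * x) = iexp (u * x) * iexp (h * x)"
        by (simp add: distrib_right distrib_left exp_add)
      moreover have "iexp ((u - h) * x) = iexp (u * x) * exp (- (\<i> * of_real (h * x)))"
        by (simp add: algebra_simps flip: exp_add)
      moreover have "iexp (h * x) + exp (- (\<i> * of_real (h * x))) = 2 * of_real (cos (h * x))"
        by (simp add: cos_exp_eq flip: cos_of_real)
      ultimately have "iexp ((u + h) * x) + iexp ((u - h) * x) = 2 * of_real (cos (h * x)) * iexp (u * x)"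
        by (metis distrib_left mult.commute)
      then show ?thesis by (simp add: field_simps)
    qed
    have int: "complex_integrable m (?e v)" for v by (rule fv_levy_measure_integrable[OF m])
    have D_int: "complex_integrable m (\<lambda>x. of_real (1 - cos (h * x)) * iexp (u * x))" for h u
      unfolding D[symmetric]
      by (intro Bochner_Integration.integrable_diff Bochner_Integration.integrable_add
            integrable_divide int)
    have D_eq: "?D (fv_exponent g m) h u = (CLINT x|m. of_real (1 - cos (h * x)) * iexp (u * x))" for h u
    proof -
      define I where "I = (\<lambda>v. CLINT x|m. ?e v x)"
      have "(CLINT x|m. ?D (\<lambda>v. ?e v x) h u) = ?D I h u"
        unfolding I_def
        by (simp only: Bochner_Integration.integral_diff Bochner_Integration.integral_add
            integral_divide_zero int Bochner_Integration.integrable_diff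
            Bochner_Integration.integrable_add integrable_divide)
      then have J: "(CLINT x|m. of_real (1 - cos (h * x)) * iexp (u * x)) = ?D I h u"
        unfolding D .
      have E: "fv_exponent g m v = \<i> * of_real (g * v) + I v" for v
        by (simp add: fv_exponent_def I_def)
      show ?thesis unfolding J E by (simp add: field_simps)
    qed
    have w_eq: "w x *\<^sub>R iexp (u * x)
        = of_real (1 - cos (1 * x)) * iexp (u * x) + of_real (1 - cos (sqrt 2 * x)) * iexp (u * x)" for x u
      by (simp add: w_def scaleR_conv_of_real algebra_simps)
    show "(CLINT x|density m (\<lambda>x. ennreal (w x)). iexp (u * x))
        = ?D (fv_exponent g m) 1 u + ?D (fv_exponent g m) (sqrt 2) u"
    proof -
      have "(CLINT x|density m (\<lambda>x. ennreal (w x)). iexp (u * x)) = (CLINT x|m. w x *\<^sub>R iexp (u * x))"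
        by (rule integral_density) (simp_all add: w0)
      also have "\<dots> = (CLINT x|m. of_real (1 - cos (1 * x)) * iexp (u * x))
          + (CLINT x|m. of_real (1 - cos (sqrt 2 * x)) * iexp (u * x))"
        unfolding w_eq by (rule Bochner_Integration.integral_add[OF D_int D_int])
      finally show ?thesis unfolding D_eq .
    qed
    show "finite_measure (density m (\<lambda>x. ennreal (w x)))"
    proof
      have "complex_integrable m (\<lambda>x. w x *\<^sub>R iexp (0 * x))"
        unfolding w_eq by (intro Bochner_Integration.integrable_add D_int)
      then have "integrable m w"
        by (simp add: scaleR_conv_of_real complex_of_real_integrable_eq)
      then show "emeasure (density m (\<lambda>x. ennreal (w x))) (space (density m (\<lambda>x. ennreal (w x)))) \<noteq> \<infinity>"
        using w0 by (simp add: emeasure_density integrable_iff_bounded less_top cong: nn_integral_cong_simp)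
    qed
  qed
  have "density \<nu> (\<lambda>x. ennreal (w x)) = density \<nu>' (\<lambda>x. ennreal (w x))"
  proof (rule finite_borel_measure_eqI_fourier)
    fix u
    show "(CLINT x|density \<nu> (\<lambda>x. ennreal (w x)). iexp (u * x))
        = (CLINT x|density \<nu>' (\<lambda>x. ennreal (w x)). iexp (u * x))"
      using fourier[OF \<nu>, of u \<gamma>] fourier[OF \<nu>', of u \<gamma>'] by (simp only: eq)
  qed (use \<nu> \<nu>' in \<open>auto intro: fin simp: fv_levy_measure_def\<close>)
  \<comment> \<open>Dividing by \<open>w\<close> recovers the measure: \<open>w\<close> vanishes at
    0 only, and a Levy measure has no atom there.\<close>
  moreover have "density (density m (\<lambda>x. ennreal (w x))) (\<lambda>x. ennreal (1 / w x)) = m"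
    if m: "fv_levy_measure m" for m
  proof -
    have [measurable_cong]: "sets m = sets borel" using m by (simp add: fv_levy_measure_def)
    have "AE x in m. x \<noteq> 0"
      using m by (intro AE_I[where N="{0}"]) (auto simp: fv_levy_measure_def)
    then have "AE x in m. ennreal (w x) * ennreal (1 / w x) = 1"
    proof eventually_elim
      case (elim x)
      then show ?case using w_pos[of x] by (simp flip: ennreal_mult)
    qed
    then show ?thesis
      by (simp add: density_density_eq density_cong[where f'="\<lambda>_. 1"] density_1)
  qed
  ultimately show ?thesis using \<nu> \<nu>' by metis
qed

section \<open>Regular Levy densities\<close>

text \<open>Sufficient conditions on \<open>\<nu>(dx) = h(x) dx\<close> that are additive in \<open>(h, \<kappa>)\<close>. Since
  \<open>\<bar>\<phi>(u)\<bar> = exp (- \<Delta> \<integral> (1 - cos (u x)) \<nu>(dx))\<close>, the last one says that \<open>1 / \<phi>(u)\<close> grows at most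
  like \<open>\<bar>u\<bar>\<close> to the power \<open>\<Delta> \<kappa>\<close>.\<close>

definition regular_levy_density :: "(real \<Rightarrow> real) \<Rightarrow> real \<Rightarrow> bool" where
  "regular_levy_density h \<kappa> \<longleftrightarrow>
     h \<in> borel_measurable borel \<and> (\<forall>x. 0 \<le> h x) \<and> 0 \<le> \<kappa> \<and>
     (\<exists>\<epsilon>>0. (\<integral>\<^sup>+x. ennreal (max \<bar>x\<bar> (\<bar>x\<bar> powr (2 + \<epsilon>)) * h x) \<partial>lborel) < \<infinity>) \<and>
     (\<exists>g. g \<in> borel_measurable borel \<and> bounded_variation_on UNIV g \<and>
        (AE x in lborel. g x = x * h x)) \<and>
     (\<exists>C\<ge>0. \<forall>u. (\<integral>\<^sup>+x. ennreal ((1 - cos (u * x)) * h x) \<partial>lborel) \<le> ennreal (\<kappa> * ln (1 + \<bar>u\<bar>) + C))"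

text \<open>The maximum with \<bar>x\<bar> keeps the moment weight from decreasing in the exponent
  on [-1, 1], where the bare power does decrease. This permits lowering \<epsilon>, either to
  reconcile two summands or to fit (c).\<close>

lemma max_abs_powr_mono:
  fixes x a b :: real
  assumes "1 \<le> a" "a \<le> b"
  shows "max \<bar>x\<bar> (\<bar>x\<bar> powr a) \<le> max \<bar>x\<bar> (\<bar>x\<bar> powr b)"
proof (cases "\<bar>x\<bar> \<le> 1")
  case True
  then have "\<bar>x\<bar> powr a \<le> \<bar>x\<bar>"
    using assms by (cases "x = 0") (auto simp: powr_mono' dest: powr_mono'[of 1 a "\<bar>x\<bar>"])
  then show ?thesis by simp
next
  case False
  then have "\<bar>x\<bar> powr a \<le> \<bar>x\<bar> powr b" using assms by (intro powr_mono) auto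
  then show ?thesis by auto
qed

lemma regular_levy_density_0: "regular_levy_density (\<lambda>_. 0) 0"
  unfolding regular_levy_density_def bounded_variation_on_def
  by (auto intro!: exI[of _ "\<lambda>_. 0 :: real"] exI[of _ "1 :: real"])

lemma regular_levy_density_add:
  assumes "regular_levy_density h \<kappa>" "regular_levy_density h' \<kappa>'"
  shows "regular_levy_density (\<lambda>x. h x + h' x) (\<kappa> + \<kappa>')"
proof -
  note h = assms(1)[unfolded regular_levy_density_def] and h' = assms(2)[unfolded regular_levy_density_def]
  have [measurable]: "h \<in> borel_measurable borel" "h' \<in> borel_measurable borel" using h h' by auto
  have nonneg: "0 \<le> h x" "0 \<le> h' x" for x using h h' by auto
  let ?m = "\<lambda>\<epsilon> x. max \<bar>x\<bar> (\<bar>x\<bar> powr (2 + \<epsilon>))"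
  obtain \<epsilon> \<epsilon>' where \<epsilon>: "0 < \<epsilon>" "(\<integral>\<^sup>+x. ennreal (?m \<epsilon> x * h x) \<partial>lborel) < \<infinity>"
    and \<epsilon>': "0 < \<epsilon>'" "(\<integral>\<^sup>+x. ennreal (?m \<epsilon>' x * h' x) \<partial>lborel) < \<infinity>"
    using h h' by auto
  obtain g g' where g: "g \<in> borel_measurable borel" "bounded_variation_on UNIV g" "AE x in lborel. g x = x * h x"
    and g': "g' \<in> borel_measurable borel" "bounded_variation_on UNIV g'" "AE x in lborel. g' x = x * h' x"
    using h h' by auto
  obtain C C' where C: "0 \<le> C"
      "\<And>u. (\<integral>\<^sup>+x. ennreal ((1 - cos (u * x)) * h x) \<partial>lborel) \<le> ennreal (\<kappa> * ln (1 + \<bar>u\<bar>) + C)"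
    and C': "0 \<le> C'"
      "\<And>u. (\<integral>\<^sup>+x. ennreal ((1 - cos (u * x)) * h' x) \<partial>lborel) \<le> ennreal (\<kappa>' * ln (1 + \<bar>u\<bar>) + C')"
    using h h' by auto
  have \<kappa>: "0 \<le> \<kappa>" "0 \<le> \<kappa>'" using h h' by auto
  have "(\<integral>\<^sup>+x. ennreal (?m (min \<epsilon> \<epsilon>') x * (h x + h' x)) \<partial>lborel)
      \<le> (\<integral>\<^sup>+x. ennreal (?m \<epsilon> x * h x) + ennreal (?m \<epsilon>' x * h' x) \<partial>lborel)"
  proof (intro nn_integral_mono)
    fix x
    have "?m (min \<epsilon> \<epsilon>') x * (h x + h' x) \<le> ?m \<epsilon> x * h x + ?m \<epsilon>' x * h' x"
      unfolding distrib_left using \<epsilon>(1) \<epsilon>'(1) nonneg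
      by (intro add_mono mult_right_mono max_abs_powr_mono) auto
    then have "ennreal (?m (min \<epsilon> \<epsilon>') x * (h x + h' x)) \<le> ennreal (?m \<epsilon> x * h x + ?m \<epsilon>' x * h' x)"
      by (rule ennreal_leI)
    also have "\<dots> = ennreal (?m \<epsilon> x * h x) + ennreal (?m \<epsilon>' x * h' x)"
      by (intro ennreal_plus mult_nonneg_nonneg max.coboundedI1 abs_ge_zero nonneg)
    finally show "ennreal (?m (min \<epsilon> \<epsilon>') x * (h x + h' x))
        \<le> ennreal (?m \<epsilon> x * h x) + ennreal (?m \<epsilon>' x * h' x)" .
  qed
  also have "\<dots> = (\<integral>\<^sup>+x. ennreal (?m \<epsilon> x * h x) \<partial>lborel) + (\<integral>\<^sup>+x. ennreal (?m \<epsilon>' x * h' x) \<partial>lborel)"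
    by (rule nn_integral_add) measurable
  also have "\<dots> < \<infinity>"
    using \<epsilon>(2) \<epsilon>'(2) unfolding infinity_ennreal_def ennreal_add_less_top by blast
  finally have fin: "(\<integral>\<^sup>+x. ennreal (?m (min \<epsilon> \<epsilon>') x * (h x + h' x)) \<partial>lborel) < \<infinity>" .
  have "0 < min \<epsilon> \<epsilon>'" using \<epsilon>(1) \<epsilon>'(1) by simp
  with fin have 1: "\<exists>\<epsilon>>0. (\<integral>\<^sup>+x. ennreal (?m \<epsilon> x * (h x + h' x)) \<partial>lborel) < \<infinity>" by blast
  have 2: "\<exists>g. g \<in> borel_measurable borel \<and> bounded_variation_on UNIV g \<and>
        (AE x in lborel. g x = x * (h x + h' x))"
  proof (intro exI[of _ "\<lambda>x. g x + g' x"] conjI bounded_variation_on_add)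
    show "AE x in lborel. g x + g' x = x * (h x + h' x)"
      using g(3) g'(3) by eventually_elim (simp add: distrib_left)
  qed (use g g' in auto)
  have 3: "(\<integral>\<^sup>+x. ennreal ((1 - cos (u * x)) * (h x + h' x)) \<partial>lborel)
      \<le> ennreal ((\<kappa> + \<kappa>') * ln (1 + \<bar>u\<bar>) + (C + C'))" for u
  proof -
    have "(\<integral>\<^sup>+x. ennreal ((1 - cos (u * x)) * (h x + h' x)) \<partial>lborel)
        = (\<integral>\<^sup>+x. ennreal ((1 - cos (u * x)) * h x) + ennreal ((1 - cos (u * x)) * h' x) \<partial>lborel)"
      using nonneg by (intro nn_integral_cong) (simp add: distrib_left ennreal_plus)
    also have "\<dots> = (\<integral>\<^sup>+x. ennreal ((1 - cos (u * x)) * h x) \<partial>lborel)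
        + (\<integral>\<^sup>+x. ennreal ((1 - cos (u * x)) * h' x) \<partial>lborel)"
      by (rule nn_integral_add) auto
    also have "\<dots> \<le> ennreal (\<kappa> * ln (1 + \<bar>u\<bar>) + C) + ennreal (\<kappa>' * ln (1 + \<bar>u\<bar>) + C')"
      by (intro add_mono C C')
    also have "\<dots> = ennreal ((\<kappa> + \<kappa>') * ln (1 + \<bar>u\<bar>) + (C + C'))"
      using \<kappa> C(1) C'(1) by (subst ennreal_plus[symmetric]) (auto simp: algebra_simps)
    finally show ?thesis .
  qed
  show ?thesis
    unfolding regular_levy_density_def
  proof (intro conjI 1 2)
    show "\<exists>C\<ge>0. \<forall>u. (\<integral>\<^sup>+x. ennreal ((1 - cos (u * x)) * (h x + h' x)) \<partial>lborel)
        \<le> ennreal ((\<kappa> + \<kappa>') * ln (1 + \<bar>u\<bar>) + C)"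
      using 3 C(1) C'(1) by (intro exI[of _ "C + C'"]) simp
  qed (use nonneg \<kappa> in auto)
qed

lemma regular_levy_density_sum:
  assumes "finite I" "\<And>i. i \<in> I \<Longrightarrow> regular_levy_density (h i) (\<kappa> i)"
  shows "regular_levy_density (\<lambda>x. \<Sum>i\<in>I. h i x) (\<Sum>i\<in>I. \<kappa> i)"
  using assms
  by (induction I rule: finite_induct) (auto intro: regular_levy_density_0 regular_levy_density_add)

lemma regular_levy_density_fv:
  assumes "regular_levy_density h \<kappa>"
  shows "fv_levy_measure (density lborel (\<lambda>x. ennreal (h x)))"
proof -
  note h = assms[unfolded regular_levy_density_def]
  have [measurable]: "h \<in> borel_measurable borel" and nonneg: "\<And>x. 0 \<le> h x" using h by auto
  obtain \<epsilon> where \<epsilon>: "0 < \<epsilon>" "(\<integral>\<^sup>+x. ennreal (max \<bar>x\<bar> (\<bar>x\<bar> powr (2 + \<epsilon>)) * h x) \<partial>lborel) < \<infinity>"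
    using h by auto
  have "(\<integral>\<^sup>+ x. ennreal (min 1 \<bar>x\<bar>) \<partial>density lborel (\<lambda>x. ennreal (h x)))
      = (\<integral>\<^sup>+x. ennreal (min 1 \<bar>x\<bar> * h x) \<partial>lborel)"
    using nonneg by (simp add: nn_integral_density ennreal_mult' mult.commute)
  also have "\<dots> \<le> (\<integral>\<^sup>+x. ennreal (max \<bar>x\<bar> (\<bar>x\<bar> powr (2 + \<epsilon>)) * h x) \<partial>lborel)"
    using nonneg by (intro nn_integral_mono ennreal_leI mult_right_mono) auto
  also note \<epsilon>(2)
  finally show ?thesis
    by (auto simp: fv_levy_measure_def emeasure_density nn_integral_null_set)
qed

lemma regular_levy_density_condition_A:
  assumes reg: "regular_levy_density h \<kappa>" and \<Delta>: "0 < \<Delta>" and small: "\<kappa> < 1 / (2 * \<Delta>)"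
    and \<nu>: "\<nu> = density lborel (\<lambda>x. ennreal (h x))"
    and [measurable]: "\<phi> \<in> borel_measurable borel"
    and \<phi>: "\<And>u. \<phi> u = exp (of_real \<Delta> * fv_exponent \<gamma> \<nu> u)"
  shows "condition_A \<nu> \<phi>"
proof -
  note h = reg[unfolded regular_levy_density_def]
  have [measurable]: "h \<in> borel_measurable borel" and nonneg: "\<And>x. 0 \<le> h x" and \<kappa>: "0 \<le> \<kappa>"
    using h by auto
  let ?m = "\<lambda>\<epsilon> x. max \<bar>x\<bar> (\<bar>x\<bar> powr (2 + \<epsilon>))"
  obtain \<epsilon>\<^sub>1 where \<epsilon>\<^sub>1: "0 < \<epsilon>\<^sub>1" "(\<integral>\<^sup>+x. ennreal (?m \<epsilon>\<^sub>1 x * h x) \<partial>lborel) < \<infinity>"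
    using h by auto
  obtain g where g[measurable]: "g \<in> borel_measurable borel"
    and bv: "bounded_variation_on UNIV g" and g_eq: "AE x in lborel. g x = x * h x"
    using h by auto
  obtain C where C: "0 \<le> C"
    "\<And>u. (\<integral>\<^sup>+x. ennreal ((1 - cos (u * x)) * h x) \<partial>lborel) \<le> ennreal (\<kappa> * ln (1 + \<bar>u\<bar>) + C)"
    using h by auto
  have \<Delta>\<kappa>: "\<Delta> * \<kappa> < 1 / 2" using small \<Delta> by (simp add: field_simps)
  \<comment> \<open>One \<epsilon> has to serve both (a) and (c): it must not exceed the moment
    exponent and must stay strictly below the gap 1/2 - \<Delta> \<kappa>; half of the gap will
    do.\<close>
  define \<epsilon> where "\<epsilon> = min \<epsilon>\<^sub>1 ((1 / 2 - \<Delta> * \<kappa>) / 2)"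
  have \<epsilon>: "0 < \<epsilon>" "\<epsilon> \<le> \<epsilon>\<^sub>1" "\<epsilon> < 1 / 2 - \<Delta> * \<kappa>"
    using \<epsilon>\<^sub>1(1) \<Delta>\<kappa> unfolding \<epsilon>_def by (auto simp: min_def)

  have moment: "(\<integral>\<^sup>+x. ennreal (?m \<epsilon> x * h x) \<partial>lborel) < \<infinity>"
    using \<epsilon> nonneg by (intro le_less_trans[OF nn_integral_mono \<epsilon>\<^sub>1(2)] ennreal_leI mult_right_mono
        max_abs_powr_mono) auto
  have a: "(\<integral>\<^sup>+x. ennreal (?m \<epsilon> x) \<partial>\<nu>) < \<infinity>"
    using moment nonneg by (simp add: \<nu> nn_integral_density ennreal_mult' mult.commute)

  have xh: "integrable lborel (\<lambda>x. x * h x)"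
  proof (rule integrableI_bounded)
    have "(\<integral>\<^sup>+x. ennreal (norm (x * h x)) \<partial>lborel) \<le> (\<integral>\<^sup>+x. ennreal (?m \<epsilon> x * h x) \<partial>lborel)"
      using nonneg by (intro nn_integral_mono ennreal_leI) (auto simp: abs_mult intro!: mult_right_mono)
    then show "(\<integral>\<^sup>+x. ennreal (norm (x * h x)) \<partial>lborel) < \<infinity>" using moment by (rule le_less_trans)
  qed simp
  \<comment> \<open>\<open>g\<close> is the version of x h(x) that is bounded everywhere; agreement
    almost everywhere suffices for all the integrals.\<close>
  have int_g: "integrable lborel g"
    using xh g_eq by (subst integrable_cong_AE[where g="\<lambda>x. x * h x"]) auto
  have b: "bounded_density_id \<nu>"
  proof -
    obtain B where "\<And>x. \<bar>g x\<bar> \<le> B" using bounded_variation_on_UNIV_bounded[OF bv] by blast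
    moreover have "(LINT x:A|\<nu>. x) = (LINT x:A|lborel. g x)" if [measurable]: "A \<in> sets borel" for A
    proof -
      have "(LINT x:A|\<nu>. x) = (LINT x|lborel. h x *\<^sub>R (indicator A x *\<^sub>R x))"
        unfolding set_lebesgue_integral_def \<nu> by (rule integral_density) (auto simp: nonneg)
      also have "\<dots> = (LINT x:A|lborel. g x)"
        unfolding set_lebesgue_integral_def using g_eq
        by (intro integral_cong_AE) (auto elim!: eventually_mono)
      finally show ?thesis .
    qed
    moreover have "integrable \<nu> (\<lambda>x. x)"
      using xh nonneg by (simp add: \<nu> integrable_density mult.commute)
    ultimately show ?thesis using int_g unfolding bounded_density_id_def by blast
  qed

  have b': "\<exists>C. \<forall>u. cmod (fourier_id \<nu> u) \<le> C * (1 + \<bar>u\<bar>) powr (-1)"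
  proof -
    obtain C where C: "\<And>u. cmod (CLINT x|lborel. of_real (g x) * iexp (u * x)) \<le> C * (1 + \<bar>u\<bar>) powr (-1)"
      using fourier_bounded_variation_decay[OF bv int_g] by blast
    have "fourier_id \<nu> u = (CLINT x|lborel. of_real (g x) * iexp (u * x))" for u
    proof -
      have "fourier_id \<nu> u = (CLINT x|lborel. h x *\<^sub>R (of_real x * iexp (u * x)))"
        unfolding fourier_id_def \<nu> by (rule integral_density) (auto simp: nonneg)
      also have "\<dots> = (CLINT x|lborel. of_real (g x) * iexp (u * x))"
        using g_eq by (intro integral_cong_AE) (auto elim!: eventually_mono simp: scaleR_conv_of_real)
      finally show ?thesis .
    qed
    then show ?thesis using C by auto
  qed

  have fv: "fv_levy_measure \<nu>" unfolding \<nu> by (rule regular_levy_density_fv[OF reg])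
  have inv: "cmod (inverse (\<phi> u)) \<le> exp (\<Delta> * C) * (1 + \<bar>u\<bar>) powr (\<Delta> * \<kappa>)" for u
  proof -
    have int: "complex_integrable \<nu> (\<lambda>x. iexp (u * x) - 1)" by (rule fv_levy_measure_integrable[OF fv])
    have "- Re (fv_exponent \<gamma> \<nu> u) = (\<integral>x. 1 - cos (u * x) \<partial>\<nu>)"
    proof -
      have "Re (fv_exponent \<gamma> \<nu> u) = Re (CLINT x|\<nu>. iexp (u * x) - 1)" by (simp add: fv_exponent_def)
      also have "\<dots> = (\<integral>x. - (1 - cos (u * x)) \<partial>\<nu>)"
        using integral_Re[OF int] by (simp add: Re_exp)
      also have "\<dots> = - (\<integral>x. 1 - cos (u * x) \<partial>\<nu>)" by (rule Bochner_Integration.integral_minus)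
      finally show ?thesis by simp
    qed
    also have "\<dots> = (\<integral>x. h x *\<^sub>R (1 - cos (u * x)) \<partial>lborel)"
      unfolding \<nu> by (rule integral_density) (auto simp: nonneg)
    also have "\<dots> = enn2real (\<integral>\<^sup>+x. ennreal (h x *\<^sub>R (1 - cos (u * x))) \<partial>lborel)"
      by (rule integral_eq_nn_integral) (auto simp: nonneg)
    also have "\<dots> \<le> enn2real (ennreal (\<kappa> * ln (1 + \<bar>u\<bar>) + C))"
      using C(2)[of u] by (intro enn2real_mono) (auto simp: mult.commute)
    also have "\<dots> = \<kappa> * ln (1 + \<bar>u\<bar>) + C"
      using \<kappa> C(1) by (intro enn2real_ennreal add_nonneg_nonneg mult_nonneg_nonneg) auto
    finally have "\<Delta> * - Re (fv_exponent \<gamma> \<nu> u) \<le> \<Delta> * (\<kappa> * ln (1 + \<bar>u\<bar>) + C)"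
      using \<Delta> by (intro mult_left_mono) auto
    then have "exp (- (\<Delta> * Re (fv_exponent \<gamma> \<nu> u))) \<le> exp (\<Delta> * C + \<Delta> * \<kappa> * ln (1 + \<bar>u\<bar>))"
      by (simp add: algebra_simps)
    also have "\<dots> = exp (\<Delta> * C) * (1 + \<bar>u\<bar>) powr (\<Delta> * \<kappa>)"
      by (simp add: exp_add powr_def)
    finally show ?thesis by (simp add: \<phi> norm_inverse exp_minus)
  qed
  have c: "integrable lborel
      (\<lambda>u. (cmod (of_real ((1 + \<bar>u\<bar>) powr (-1 + \<epsilon>)) * inverse (\<phi> u)))\<^sup>2)"
  proof (rule Bochner_Integration.integrable_bound)
    \<comment> \<open>Squaring the power -1 + \<epsilon> + \<Delta> \<kappa> of 1 + \<bar>u\<bar>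
      gives the exponent \<open>- s\<close>. Integrability needs \<open>s\<close> > 1, which is how
      \<epsilon> was chosen.\<close>
    define s where "s = 2 - 2 * \<epsilon> - 2 * (\<Delta> * \<kappa>)"
    have "1 < s" using \<epsilon> unfolding s_def by linarith
    then show "integrable lborel (\<lambda>u::real. (exp (\<Delta> * C))\<^sup>2 * (1 + \<bar>u\<bar>) powr (- s))"
      by (intro integrable_mult_right integrable_one_plus_abs_powr)
    show "AE u in lborel. norm ((cmod (of_real ((1 + \<bar>u\<bar>) powr (-1 + \<epsilon>)) * inverse (\<phi> u)))\<^sup>2)
        \<le> norm ((exp (\<Delta> * C))\<^sup>2 * (1 + \<bar>u\<bar>) powr (- s))"
    proof (rule AE_I2)
      fix u :: real
      have "cmod (of_real ((1 + \<bar>u\<bar>) powr (-1 + \<epsilon>)) * inverse (\<phi> u))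
          \<le> (1 + \<bar>u\<bar>) powr (-1 + \<epsilon>) * (exp (\<Delta> * C) * (1 + \<bar>u\<bar>) powr (\<Delta> * \<kappa>))"
        unfolding norm_mult using inv[of u] by (intro mult_mono) auto
      also have "\<dots> = exp (\<Delta> * C) * (1 + \<bar>u\<bar>) powr (- s / 2)"
      proof -
        have "- s / 2 = (-1 + \<epsilon>) + \<Delta> * \<kappa>" by (simp add: s_def field_simps)
        then show ?thesis by (simp only: powr_add mult.left_commute)
      qed
      finally have "(cmod (of_real ((1 + \<bar>u\<bar>) powr (-1 + \<epsilon>)) * inverse (\<phi> u)))\<^sup>2
          \<le> (exp (\<Delta> * C) * (1 + \<bar>u\<bar>) powr (- s / 2))\<^sup>2"
        by (intro power_mono) auto
      also have "\<dots> = (exp (\<Delta> * C))\<^sup>2 * (1 + \<bar>u\<bar>) powr (- s)"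
        by (simp add: power_mult_distrib power2_eq_square flip: powr_add)
      finally show "norm ((cmod (of_real ((1 + \<bar>u\<bar>) powr (-1 + \<epsilon>)) * inverse (\<phi> u)))\<^sup>2)
        \<le> norm ((exp (\<Delta> * C))\<^sup>2 * (1 + \<bar>u\<bar>) powr (- s))" by simp
    qed
  qed simp
  show ?thesis
    unfolding condition_A_def using \<epsilon>(1) a b b' c by (intro exI[of _ \<epsilon>]) auto
qed

section \<open>Regularity of the densities of finite activity, self-decomposable and Gamma
  type\<close>

lemma regular_levy_density_finite_activity:
  assumes [measurable]: "f \<in> borel_measurable borel" and nonneg: "\<And>x. 0 \<le> f x"
    and bv: "bounded_variation_on UNIV (\<lambda>x. x * f x)"
    and fin: "(\<integral>\<^sup>+x. ennreal (f x) \<partial>lborel) < \<infinity>"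
    and \<epsilon>: "0 < \<epsilon>" and moment: "(\<integral>\<^sup>+x. ennreal (\<bar>x\<bar> powr (2 + \<epsilon>) * f x) \<partial>lborel) < \<infinity>"
  shows "regular_levy_density f 0"
  unfolding regular_levy_density_def
proof (intro conjI)
  show "\<exists>\<epsilon>>0. (\<integral>\<^sup>+x. ennreal (max \<bar>x\<bar> (\<bar>x\<bar> powr (2 + \<epsilon>)) * f x) \<partial>lborel) < \<infinity>"
  proof (intro exI[of _ \<epsilon>] conjI \<epsilon>)
    have "(\<integral>\<^sup>+x. ennreal (max \<bar>x\<bar> (\<bar>x\<bar> powr (2 + \<epsilon>)) * f x) \<partial>lborel)
        \<le> (\<integral>\<^sup>+x. ennreal (f x) + ennreal (\<bar>x\<bar> powr (2 + \<epsilon>) * f x) \<partial>lborel)"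
    proof (intro nn_integral_mono)
      fix x :: real
      \<comment> \<open>The finite mass controls the first moment on [-1, 1], the higher moment
        controls it outside.\<close>
      have "max \<bar>x\<bar> (\<bar>x\<bar> powr (2 + \<epsilon>)) \<le> 1 + \<bar>x\<bar> powr (2 + \<epsilon>)"
      proof (cases "\<bar>x\<bar> \<le> 1")
        case False
        then have "\<bar>x\<bar> powr 1 \<le> \<bar>x\<bar> powr (2 + \<epsilon>)" using \<epsilon> by (intro powr_mono) auto
        then show ?thesis using False by simp
      qed (simp add: add_increasing2)
      then have "max \<bar>x\<bar> (\<bar>x\<bar> powr (2 + \<epsilon>)) * f x \<le> (1 + \<bar>x\<bar> powr (2 + \<epsilon>)) * f x"
        by (intro mult_right_mono nonneg)
      also have "\<dots> = f x + \<bar>x\<bar> powr (2 + \<epsilon>) * f x" by (simp add: distrib_right)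
      finally have "ennreal (max \<bar>x\<bar> (\<bar>x\<bar> powr (2 + \<epsilon>)) * f x) \<le> ennreal (f x + \<bar>x\<bar> powr (2 + \<epsilon>) * f x)"
        by (rule ennreal_leI)
      then show "ennreal (max \<bar>x\<bar> (\<bar>x\<bar> powr (2 + \<epsilon>)) * f x) \<le> ennreal (f x) + ennreal (\<bar>x\<bar> powr (2 + \<epsilon>) * f x)"
        by (simp add: ennreal_plus nonneg)
    qed
    also have "\<dots> = (\<integral>\<^sup>+x. ennreal (f x) \<partial>lborel) + (\<integral>\<^sup>+x. ennreal (\<bar>x\<bar> powr (2 + \<epsilon>) * f x) \<partial>lborel)"
      by (rule nn_integral_add) measurable
    also have "\<dots> < \<infinity>"
      using fin moment unfolding infinity_ennreal_def ennreal_add_less_top by blast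
    finally show "(\<integral>\<^sup>+x. ennreal (max \<bar>x\<bar> (\<bar>x\<bar> powr (2 + \<epsilon>)) * f x) \<partial>lborel) < \<infinity>" .
  qed
  show "\<exists>g. g \<in> borel_measurable borel \<and> bounded_variation_on UNIV g \<and> (AE x in lborel. g x = x * f x)"
    using bv by (intro exI[of _ "\<lambda>x. x * f x"]) auto
  define K where "K = enn2real (\<integral>\<^sup>+x. ennreal (f x) \<partial>lborel)"
  have K: "(\<integral>\<^sup>+x. ennreal (f x) \<partial>lborel) = ennreal K" "0 \<le> K"
    using fin by (simp_all add: K_def)
  have "(\<integral>\<^sup>+x. ennreal ((1 - cos (u * x)) * f x) \<partial>lborel) \<le> ennreal (2 * K)" for u
  proof -
    have "(\<integral>\<^sup>+x. ennreal ((1 - cos (u * x)) * f x) \<partial>lborel) \<le> (\<integral>\<^sup>+x. ennreal 2 * ennreal (f x) \<partial>lborel)"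
    proof (intro nn_integral_mono)
      fix x
      have "1 - cos (u * x) \<le> 2" using cos_ge_minus_one[of "u * x"] by linarith
      then show "ennreal ((1 - cos (u * x)) * f x) \<le> ennreal 2 * ennreal (f x)"
        using nonneg by (subst ennreal_mult[symmetric]) (auto intro!: ennreal_leI mult_right_mono)
    qed
    also have "\<dots> = ennreal (2 * K)"
      using K by (simp add: nn_integral_cmult ennreal_mult)
    finally show ?thesis .
  qed
  then show "\<exists>C\<ge>0. \<forall>u. (\<integral>\<^sup>+x. ennreal ((1 - cos (u * x)) * f x) \<partial>lborel) \<le> ennreal (0 * ln (1 + \<bar>u\<bar>) + C)"
    using K(2) by (intro exI[of _ "2 * K"]) simp
qed (use nonneg in auto)

text \<open>Monotonicity bounds \<open>k\<close> by its one-sided limits, so on [-1, 1] the density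
  is at most q / x or p / \<bar>x\<bar>, with exact constants. Outside, 1 / \<bar>x\<bar> \<le> 1
  and the integrability of \<open>k\<close> gives O(1).\<close>

lemma regular_levy_density_selfdecomposable:
  assumes k: "k_function \<nu> k p q" and \<epsilon>: "0 < \<epsilon>"
    and moment: "(\<integral>\<^sup>+x. ennreal (max 1 (\<bar>x\<bar> powr (1 + \<epsilon>)) * k x) \<partial>lborel) < \<infinity>"
  shows "regular_levy_density (\<lambda>x. k x / \<bar>x\<bar>) (p + q)"
proof -
  have nonneg: "0 \<le> k x" for x using k by (simp add: k_function_def)
  have left_mono: "k x \<le> k y" if "x \<le> y" "y < 0" for x y
    using k that by (intro mono_onD[of "{..<0}" k]) (auto simp: k_function_def)
  have right_mono: "k y \<le> k x" if "x \<le> y" "0 < x" for x y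
    using k that by (intro monotone_onD[of "{0<..}" "(\<le>)" "(\<ge>)" k]) (auto simp: k_function_def)
  have p_lim: "(k \<longlongrightarrow> p) (at_left 0)" and q_lim: "(k \<longlongrightarrow> q) (at_right 0)"
    using k by (auto simp: k_function_def)
  have kp: "k x \<le> p" if "x < 0" for x
  proof (rule tendsto_lowerbound[OF p_lim])
    show "\<forall>\<^sub>F y in at_left 0. k x \<le> k y"
      using that by (auto simp: eventually_at_left intro!: exI[of _ x] left_mono)
  qed simp
  have kq: "k x \<le> q" if "0 < x" for x
  proof (rule tendsto_lowerbound[OF q_lim])
    show "\<forall>\<^sub>F y in at_right 0. k x \<le> k y"
      using that by (auto simp: eventually_at_right intro!: exI[of _ x] right_mono)
  qed simp
  have pq: "0 \<le> p" "0 \<le> q" using kp[of "-1"] kq[of 1] nonneg[of "-1"] nonneg[of 1] by linarith+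
  \<comment> \<open>Away from \<open>0\<close>, \<open>x h(x) = sgn x k(x)\<close> is the sum of a decreasing function \<open>a\<close> and a jump \<open>J\<close>.\<close>
  define a where "a = (\<lambda>x. if x < 0 then - k x else if x = 0 then - p else k x - p - q)"
  define J where "J = (\<lambda>x::real. if x \<le> 0 then 0 else p + q)"
  \<comment> \<open>Left of 0 the values of \<open>a\<close> are at least \<open>- p\<close>;
    subtracting \<open>p + q\<close> on the right brings the values there down to at most
    \<open>- p\<close>, so the branches join in decreasing order.\<close>
  have "mono (\<lambda>x. - a x)"
  proof (rule monoI)
    fix x y :: real assume "x \<le> y"
    consider "y < 0" | "x < 0" "y = 0" | "x < 0" "0 < y" | "x = 0" "y = 0" | "x = 0" "0 < y" | "0 < x"
      using \<open>x \<le> y\<close> by linarith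
    then show "- a x \<le> - a y"
      using \<open>x \<le> y\<close> left_mono[of x y] right_mono[of x y] kp[of x] kq[of y] by cases (auto simp: a_def)
  qed
  then have a_anti: "antimono a" by (simp add: monotone_def)
  have J_mono: "mono J" using pq by (auto simp: J_def mono_def)
  have [measurable]: "a \<in> borel_measurable borel" "J \<in> borel_measurable borel"
    using borel_measurable_mono[OF \<open>mono (\<lambda>x. - a x)\<close>] borel_measurable_mono[OF J_mono] by simp_all
  have aJ: "a x + J x = sgn x * k x" if "x \<noteq> 0" for x
    using that by (auto simp: a_def J_def)
  have h_eq: "k x / \<bar>x\<bar> = (a x + J x) / x" for x
    using aJ[of x] by (cases "x = 0") (auto simp: abs_if sgn_if)
  have [measurable]: "(\<lambda>x. k x / \<bar>x\<bar>) \<in> borel_measurable borel"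
    unfolding h_eq by measurable
  \<comment> \<open>Measurability of \<open>k\<close> comes from monotonicity: off 0 it is built
    from two monotone functions, which are Borel.\<close>
  have k_eq: "k = (\<lambda>x. if x = 0 then k 0 else \<bar>a x + J x\<bar>)"
    using aJ nonneg by (auto simp: abs_mult)
  have [measurable]: "k \<in> borel_measurable borel"
    by (subst k_eq) measurable
  have bv: "bounded_variation_on UNIV (\<lambda>x. a x + J x)"
  proof (intro bounded_variation_on_add)
    have "\<bar>a x\<bar> \<le> p + q" for x
      using nonneg[of x] kp[of x] kq[of x] pq by (auto simp: a_def)
    then show "bounded_variation_on UNIV a"
      using a_anti by (intro bounded_variation_on_monotone_bounded[of _ "p + q"]) auto
    have "\<bar>J x\<bar> \<le> p + q" for x using pq by (auto simp: J_def)
    then show "bounded_variation_on UNIV J"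
      using J_mono by (intro bounded_variation_on_monotone_bounded[of _ "p + q"]) auto
  qed
  have "(\<integral>\<^sup>+x. ennreal (k x) \<partial>lborel)
      \<le> (\<integral>\<^sup>+x. ennreal (max 1 (\<bar>x\<bar> powr (1 + \<epsilon>)) * k x) \<partial>lborel)"
  proof (intro nn_integral_mono ennreal_leI)
    fix x
    have "1 * k x \<le> max 1 (\<bar>x\<bar> powr (1 + \<epsilon>)) * k x" by (intro mult_right_mono nonneg) simp
    then show "k x \<le> max 1 (\<bar>x\<bar> powr (1 + \<epsilon>)) * k x" by simp
  qed
  then have fin: "(\<integral>\<^sup>+x. ennreal (k x) \<partial>lborel) < \<infinity>" using moment by (rule le_less_trans)
  define K where "K = enn2real (\<integral>\<^sup>+x. ennreal (k x) \<partial>lborel)"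
  have K: "(\<integral>\<^sup>+x. ennreal (k x) \<partial>lborel) = ennreal K" "0 \<le> K"
    using fin by (simp_all add: K_def)
  \<comment> \<open>\<open>c u\<close> compares on the right half-line; its mirror image
    \<open>c u (- x)\<close> does so on the left.\<close>
  define c where "c = (\<lambda>u x::real. (1 - cos (u * x)) / x * indicator {0<..1} x)"
  have c0: "0 \<le> c u x" for u x by (auto simp: c_def indicator_def)
  have [measurable]: "c u \<in> borel_measurable borel" for u by (simp add: c_def)
  have "(\<integral>\<^sup>+x. ennreal ((1 - cos (u * x)) * (k x / \<bar>x\<bar>)) \<partial>lborel)
      \<le> ennreal ((p + q) * ln (1 + \<bar>u\<bar>) + ((p + q) * 4 + 2 * K))" for u
  proof -
    let ?L = "ln (1 + \<bar>u\<bar>) + 4"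
    have L: "(\<integral>\<^sup>+x. ennreal (c u x) \<partial>lborel) \<le> ennreal ?L" "0 \<le> ?L"
      using nn_integral_one_minus_cos_over_x[of u] by (simp_all add: c_def add_nonneg_nonneg)
    have "(\<integral>\<^sup>+x. ennreal ((1 - cos (u * x)) * (k x / \<bar>x\<bar>)) \<partial>lborel)
        \<le> (\<integral>\<^sup>+x. ennreal q * ennreal (c u x) + ennreal p * ennreal (c u (- x))
            + ennreal 2 * ennreal (k x) \<partial>lborel)"
    proof (intro nn_integral_mono)
      fix x
      have "(1 - cos (u * x)) * (k x / \<bar>x\<bar>) \<le> q * c u x + p * c u (- x) + 2 * k x"
      proof -
        have cos: "0 \<le> 1 - cos (u * x)" "1 - cos (u * x) \<le> 2"
          using cos_ge_minus_one[of "u * x"] cos_le_one[of "u * x"] by linarith+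
        consider "x = 0" | "1 < \<bar>x\<bar>" | "0 < x" "x \<le> 1" | "x < 0" "- 1 \<le> x" by linarith
        then show ?thesis
        proof cases
          case 1 then show ?thesis using nonneg[of x] by (simp add: c_def)
        next
          case 2
          have "(1 - cos (u * x)) * (k x / \<bar>x\<bar>) \<le> 2 * (k x / 1)"
            using 2 cos nonneg[of x] by (intro mult_mono divide_left_mono) auto
          then show ?thesis using c0[of u x] c0[of u "- x"] pq by (simp add: add_increasing)
        next
          case 3
          have "(1 - cos (u * x)) * (k x / \<bar>x\<bar>) \<le> (1 - cos (u * x)) * (q / x)"
            using 3 cos kq[of x] by (intro mult_left_mono) (auto simp: divide_right_mono)
          also have "\<dots> = q * c u x" using 3 by (simp add: c_def)
          finally show ?thesis using c0[of u "- x"] pq nonneg[of x] by (simp add: add_increasing2)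
        next
          case 4
          have "(1 - cos (u * x)) * (k x / \<bar>x\<bar>) \<le> (1 - cos (u * x)) * (p / (- x))"
            using 4 cos divide_right_mono[OF kp[of x], of "- x"]
            by (intro mult_left_mono) (auto simp: abs_of_neg)
          also have "\<dots> = p * c u (- x)" using 4 by (simp add: c_def)
          finally show ?thesis using c0[of u x] pq nonneg[of x] by (simp add: add_increasing add_increasing2)
        qed
      qed
      then have "ennreal ((1 - cos (u * x)) * (k x / \<bar>x\<bar>)) \<le> ennreal (q * c u x + p * c u (- x) + 2 * k x)"
        by (rule ennreal_leI)
      then show "ennreal ((1 - cos (u * x)) * (k x / \<bar>x\<bar>))
          \<le> ennreal q * ennreal (c u x) + ennreal p * ennreal (c u (- x)) + ennreal 2 * ennreal (k x)"
        using pq c0 nonneg by (simp add: ennreal_plus ennreal_mult)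
    qed
    also have "\<dots> = ennreal q * (\<integral>\<^sup>+x. ennreal (c u x) \<partial>lborel)
        + ennreal p * (\<integral>\<^sup>+x. ennreal (c u (- x)) \<partial>lborel) + ennreal 2 * (\<integral>\<^sup>+x. ennreal (k x) \<partial>lborel)"
      by (simp add: nn_integral_add nn_integral_cmult)
    also have "(\<integral>\<^sup>+x. ennreal (c u (- x)) \<partial>lborel) = (\<integral>\<^sup>+x. ennreal (c u x) \<partial>lborel)"
      by (subst (2) nn_integral_real_affine[where c="-1" and t=0]) auto
    also have "ennreal q * (\<integral>\<^sup>+x. ennreal (c u x) \<partial>lborel)
        + ennreal p * (\<integral>\<^sup>+x. ennreal (c u x) \<partial>lborel) + ennreal 2 * (\<integral>\<^sup>+x. ennreal (k x) \<partial>lborel)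
        \<le> ennreal q * ennreal ?L + ennreal p * ennreal ?L + ennreal 2 * ennreal K"
      unfolding K(1) by (intro add_mono mult_left_mono L(1)) auto
    also have "\<dots> = ennreal (q * ?L + p * ?L + 2 * K)"
      using pq L(2) K(2) by (simp add: ennreal_plus ennreal_mult)
    also have "q * ?L + p * ?L + 2 * K = (p + q) * ln (1 + \<bar>u\<bar>) + ((p + q) * 4 + 2 * K)"
      by (simp add: algebra_simps)
    finally show ?thesis .
  qed
  then have decay: "\<exists>C\<ge>0. \<forall>u. (\<integral>\<^sup>+x. ennreal ((1 - cos (u * x)) * (k x / \<bar>x\<bar>)) \<partial>lborel)
      \<le> ennreal ((p + q) * ln (1 + \<bar>u\<bar>) + C)"
    using pq K(2) by (intro exI[of _ "(p + q) * 4 + 2 * K"]) simp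
  have "(\<integral>\<^sup>+x. ennreal (max \<bar>x\<bar> (\<bar>x\<bar> powr (2 + \<epsilon>)) * (k x / \<bar>x\<bar>)) \<partial>lborel)
      \<le> (\<integral>\<^sup>+x. ennreal (max 1 (\<bar>x\<bar> powr (1 + \<epsilon>)) * k x) \<partial>lborel)"
  proof (intro nn_integral_mono ennreal_leI)
    fix x
    show "max \<bar>x\<bar> (\<bar>x\<bar> powr (2 + \<epsilon>)) * (k x / \<bar>x\<bar>) \<le> max 1 (\<bar>x\<bar> powr (1 + \<epsilon>)) * k x"
    proof (cases "x = 0")
      case False
      \<comment> \<open>Dividing the weight of (a) by \<bar>x\<bar> gives exactly the weight in the
        hypothesis on \<open>k\<close>.\<close>
      have "\<bar>x\<bar> powr (2 + \<epsilon>) = \<bar>x\<bar> powr 1 * \<bar>x\<bar> powr (1 + \<epsilon>)" by (simp only: flip: powr_add) simp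
      then have "max \<bar>x\<bar> (\<bar>x\<bar> powr (2 + \<epsilon>)) = \<bar>x\<bar> * max 1 (\<bar>x\<bar> powr (1 + \<epsilon>))"
        by (simp add: max_mult_distrib_left)
      then show ?thesis using False by simp
    qed (use nonneg in simp)
  qed
  then have "(\<integral>\<^sup>+x. ennreal (max \<bar>x\<bar> (\<bar>x\<bar> powr (2 + \<epsilon>)) * (k x / \<bar>x\<bar>)) \<partial>lborel) < \<infinity>"
    using moment by (rule le_less_trans)
  then have moment': "\<exists>\<epsilon>>0. (\<integral>\<^sup>+x. ennreal (max \<bar>x\<bar> (\<bar>x\<bar> powr (2 + \<epsilon>)) * (k x / \<bar>x\<bar>)) \<partial>lborel) < \<infinity>"
    using \<epsilon> by blast
  \<comment> \<open>At 0 the left side is \<open>- p\<close> and the right side is 0, hence only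
    almost everywhere.\<close>
  have "AE x in lborel. a x + J x = x * (k x / \<bar>x\<bar>)"
    using AE_lborel_singleton[of 0] by eventually_elim (simp add: h_eq)
  then have "\<exists>g. g \<in> borel_measurable borel \<and> bounded_variation_on UNIV g \<and>
      (AE x in lborel. g x = x * (k x / \<bar>x\<bar>))"
    using bv by (intro exI[of _ "\<lambda>x. a x + J x"]) auto
  then show ?thesis
    unfolding regular_levy_density_def using moment' decay pq nonneg by simp
qed

lemma nn_integral_exp_decay_finite:
  assumes "0 < b"
  shows "(\<integral>\<^sup>+x. ennreal (exp (- b * x) * indicator {0<..} x) \<partial>lborel) < \<infinity>"
proof -
  have "(\<integral>\<^sup>+x. ennreal (exp (- b * x) * indicator {0<..} x) \<partial>lborel)
      \<le> (\<integral>\<^sup>+x. ennreal (exp (- b * x)) * indicator {0..} x \<partial>lborel)"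
    by (intro nn_integral_mono) (simp add: indicator_def)
  also have "\<dots> = ennreal (0 - - exp (- b * 0) / b)"
  proof (rule nn_integral_FTC_atLeast)
    show "((\<lambda>x. - exp (- b * x) / b) has_real_derivative exp (- b * x)) (at x)" for x
      using assms by (auto intro!: derivative_eq_intros)
    have "LIM x at_top. - b * x :> at_bot"
      using assms by (intro filterlim_tendsto_neg_mult_at_bot[OF tendsto_const _ filterlim_ident]) auto
    then have "((\<lambda>x. exp (- b * x)) \<longlongrightarrow> 0) at_top"
      by (rule filterlim_compose[OF exp_at_bot])
    then show "((\<lambda>x. - exp (- b * x) / b) \<longlongrightarrow> 0) at_top"
      by (intro tendsto_divide_zero tendsto_minus_cancel_left[THEN iffD1]) simp
  qed auto
  finally show ?thesis by (simp add: le_less_trans)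
qed

text \<open>Half of the decay rate is spent on the square: \<open>(l / 2 * x)\<^sup>2 / 2\<close> is
  at most \<open>exp (l / 2 * x)\<close>, and solving for the square of \<open>x\<close> produces
  the factor \<open>8 / l\<^sup>2\<close>.\<close>

lemma power2_exp_decay_le:
  assumes "0 < l" "0 \<le> x"
  shows "(1 + x\<^sup>2) * exp (- l * x) \<le> (1 + 8 / l\<^sup>2) * exp (- (l / 2) * (x::real))"
proof -
  have "x\<^sup>2 = 8 / l\<^sup>2 * ((l / 2 * x)\<^sup>2 / 2)" using assms by (simp add: field_simps power2_eq_square)
  also have "\<dots> \<le> 8 / l\<^sup>2 * exp (l / 2 * x)"
  proof (rule mult_left_mono)
    have "0 \<le> l / 2 * x" using assms by simp
    then show "(l / 2 * x)\<^sup>2 / 2 \<le> exp (l / 2 * x)"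
      using exp_lower_Taylor_quadratic[of "l / 2 * x"] by linarith
  qed simp
  finally have "1 + x\<^sup>2 \<le> 1 * exp (l / 2 * x) + 8 / l\<^sup>2 * exp (l / 2 * x)"
    using assms by (intro add_mono) auto
  then have "(1 + x\<^sup>2) * exp (- l * x) \<le> ((1 + 8 / l\<^sup>2) * exp (l / 2 * x)) * exp (- l * x)"
    by (intro mult_right_mono) (auto simp: distrib_right)
  also have "\<dots> = (1 + 8 / l\<^sup>2) * exp (- (l / 2) * x)"
    by (simp add: mult.assoc flip: exp_add)
  finally show ?thesis .
qed

lemma nn_integral_power2_exp_decay_finite:
  assumes "0 < l"
  shows "(\<integral>\<^sup>+x. ennreal ((1 + x\<^sup>2) * exp (- l * x) * indicator {0<..} x) \<partial>lborel) < \<infinity>"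
proof -
  have "(\<integral>\<^sup>+x. ennreal ((1 + x\<^sup>2) * exp (- l * x) * indicator {0<..} x) \<partial>lborel)
      \<le> (\<integral>\<^sup>+x. ennreal (1 + 8 / l\<^sup>2) * ennreal (exp (- (l / 2) * x) * indicator {0<..} x) \<partial>lborel)"
  proof (intro nn_integral_mono)
    fix x :: real
    have "(1 + x\<^sup>2) * exp (- l * x) * indicator {0<..} x
        \<le> (1 + 8 / l\<^sup>2) * (exp (- (l / 2) * x) * indicator {0<..} x)"
      using power2_exp_decay_le[OF assms, of x] by (cases "0 < x") simp_all
    then have "ennreal ((1 + x\<^sup>2) * exp (- l * x) * indicator {0<..} x)
        \<le> ennreal ((1 + 8 / l\<^sup>2) * (exp (- (l / 2) * x) * indicator {0<..} x))"
      by (rule ennreal_leI)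
    also have "\<dots> = ennreal (1 + 8 / l\<^sup>2) * ennreal (exp (- (l / 2) * x) * indicator {0<..} x)"
      by (rule ennreal_mult) (auto intro: add_nonneg_nonneg)
    finally show "ennreal ((1 + x\<^sup>2) * exp (- l * x) * indicator {0<..} x)
        \<le> ennreal (1 + 8 / l\<^sup>2) * ennreal (exp (- (l / 2) * x) * indicator {0<..} x)" .
  qed
  also have "\<dots> < \<infinity>"
    using nn_integral_exp_decay_finite[of "l / 2"] assms
    by (simp add: nn_integral_cmult ennreal_mult_less_top)
  finally show ?thesis .
qed

definition gamma_k :: "real \<Rightarrow> real \<Rightarrow> real \<Rightarrow> real" where
  "gamma_k \<alpha> l x = (if 0 < x then \<alpha> * exp (- l * x) else 0)"

lemma regular_levy_density_gamma:
  assumes "0 < \<alpha>" "0 < l"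
  shows "regular_levy_density (\<lambda>x. gamma_k \<alpha> l x / \<bar>x\<bar>) \<alpha>"
proof -
  have [measurable]: "gamma_k \<alpha> l \<in> borel_measurable borel" unfolding gamma_k_def by measurable
  have "regular_levy_density (\<lambda>x. gamma_k \<alpha> l x / \<bar>x\<bar>) (0 + \<alpha>)"
  proof (rule regular_levy_density_selfdecomposable)
    show "k_function (density lborel (\<lambda>x. ennreal (gamma_k \<alpha> l x / \<bar>x\<bar>))) (gamma_k \<alpha> l) 0 \<alpha>"
      unfolding k_function_def
    proof (intro conjI refl)
      show "mono_on {..<0} (gamma_k \<alpha> l)" by (auto simp: mono_on_def gamma_k_def)
      show "antimono_on {0<..} (gamma_k \<alpha> l)"
        using assms by (auto simp: monotone_on_def gamma_k_def)
      have "\<forall>\<^sub>F x in at_left 0. 0 = gamma_k \<alpha> l x"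
        unfolding eventually_at_filter by (auto simp: gamma_k_def)
      then show "(gamma_k \<alpha> l \<longlongrightarrow> 0) (at_left 0)" by (rule Lim_transform_eventually[OF tendsto_const])
      have "((\<lambda>x. \<alpha> * exp (- l * x)) \<longlongrightarrow> \<alpha>) (at_right 0)"
        by (auto intro!: tendsto_eq_intros)
      moreover have "\<forall>\<^sub>F x in at_right 0. \<alpha> * exp (- l * x) = gamma_k \<alpha> l x"
        unfolding eventually_at_filter by (auto simp: gamma_k_def)
      ultimately show "(gamma_k \<alpha> l \<longlongrightarrow> \<alpha>) (at_right 0)" by (rule Lim_transform_eventually)
    qed (use assms in \<open>auto simp: gamma_k_def\<close>)
    \<comment> \<open>Exponential decay leaves \<epsilon> free; the value 1 makes the weight at most
      \<open>1 + x\<^sup>2\<close>.\<close>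
    have "(\<integral>\<^sup>+x. ennreal (max 1 (\<bar>x\<bar> powr (1 + 1)) * gamma_k \<alpha> l x) \<partial>lborel)
        \<le> (\<integral>\<^sup>+x. ennreal \<alpha> * ennreal ((1 + x\<^sup>2) * exp (- l * x) * indicator {0<..} x) \<partial>lborel)"
    proof (intro nn_integral_mono)
      fix x :: real
      have "max 1 (\<bar>x\<bar> powr (1 + 1)) * gamma_k \<alpha> l x \<le> \<alpha> * ((1 + x\<^sup>2) * exp (- l * x) * indicator {0<..} x)"
      proof (cases "0 < x")
        case True
        then have "max 1 (\<bar>x\<bar> powr (1 + 1)) \<le> 1 + x\<^sup>2" by simp
        then have "max 1 (\<bar>x\<bar> powr (1 + 1)) * (\<alpha> * exp (- l * x)) \<le> (1 + x\<^sup>2) * (\<alpha> * exp (- l * x))"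
          using assms by (intro mult_right_mono) auto
        then show ?thesis using True by (simp add: gamma_k_def mult_ac)
      qed (simp add: gamma_k_def)
      then show "ennreal (max 1 (\<bar>x\<bar> powr (1 + 1)) * gamma_k \<alpha> l x)
          \<le> ennreal \<alpha> * ennreal ((1 + x\<^sup>2) * exp (- l * x) * indicator {0<..} x)"
        using assms by (subst ennreal_mult[symmetric]) (auto intro!: ennreal_leI)
    qed
    also have "\<dots> < \<infinity>"
      using nn_integral_power2_exp_decay_finite[OF assms(2)]
      by (simp add: nn_integral_cmult ennreal_mult_less_top)
    finally show "(\<integral>\<^sup>+x. ennreal (max 1 (\<bar>x\<bar> powr (1 + 1)) * gamma_k \<alpha> l x) \<partial>lborel) < \<infinity>" .
  qed simp
  then show ?thesis by simp
qed

section \<open>Identification of the Levy measure from the process\<close>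

lemma tendsto_exp_difference_quotient:
  fixes z :: complex and s :: "nat \<Rightarrow> real"
  assumes "s \<longlonglongrightarrow> 0" "\<And>n. 0 < s n"
  shows "(\<lambda>n. (exp (of_real (s n) * z) - 1) / of_real (s n)) \<longlonglongrightarrow> z"
proof -
  have "((\<lambda>w. exp (w * z)) has_field_derivative z) (at 0)"
    by (auto intro!: derivative_eq_intros)
  then have "((\<lambda>h. (exp (h * z) - 1) / h) \<longlongrightarrow> z) (at 0)"
    by (simp add: DERIV_def)
  moreover have "filterlim (\<lambda>n. complex_of_real (s n)) (at 0) sequentially"
    using assms tendsto_of_real[OF assms(1), where 'a=complex]
    by (auto simp: filterlim_at less_imp_neq[symmetric])
  ultimately show ?thesis by (rule filterlim_compose)
qed

text \<open>The exponent is read off as the time derivative at 0 of the characteristic function. No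
  logarithm is taken, so no branch has to be chosen; the price is that laws at arbitrarily small
  times must be known.\<close>

lemma fv_levy_process_measure_eqI:
  assumes X: "fv_levy_process M X \<gamma> \<nu>" and \<nu>': "fv_levy_measure \<nu>'"
    and s: "s \<longlonglongrightarrow> 0" "\<And>n. 0 < s n"
    and lim: "\<And>u. (\<lambda>n. (char (distr M borel (X (s n))) u - 1) / of_real (s n)) \<longlonglongrightarrow> fv_exponent \<gamma>' \<nu>' u"
  shows "\<nu> = \<nu>'"
proof (rule fv_exponent_unique)
  show "fv_levy_measure \<nu>" using X by (simp add: fv_levy_process_def)
  fix u
  have "(\<lambda>n. (exp (of_real (s n) * fv_exponent \<gamma> \<nu> u) - 1) / of_real (s n)) \<longlonglongrightarrow> fv_exponent \<gamma>' \<nu>' u"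
    using lim[of u] X s(2) by (simp add: fv_levy_process_def less_imp_le)
  then show "fv_exponent \<gamma> \<nu> u = fv_exponent \<gamma>' \<nu>' u"
    by (rule LIMSEQ_unique[OF tendsto_exp_difference_quotient[OF s]])
qed (fact \<nu>')

lemma isCont_fv_exponent:
  assumes "fv_levy_measure \<nu>"
  shows "isCont (fv_exponent \<gamma> \<nu>) u"
proof -
  have [measurable_cong]: "sets \<nu> = sets borel" using assms by (simp add: fv_levy_measure_def)
  have "isCont (\<lambda>u. CLINT x|\<nu>. iexp (u * x) - 1) u"
    unfolding continuous_at_sequentially
  proof (intro allI impI)
    fix v :: "nat \<Rightarrow> real" assume v: "v \<longlonglongrightarrow> u"
    then obtain B where B: "\<And>n. \<bar>v n\<bar> \<le> B"
      by (metis convergentI convergent_imp_Bseq BseqE real_norm_def)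
    have "(\<lambda>n. CLINT x|\<nu>. iexp (v n * x) - 1) \<longlonglongrightarrow> (CLINT x|\<nu>. iexp (u * x) - 1)"
    proof (rule integral_dominated_convergence[where w="\<lambda>x. (2 + B) * min 1 \<bar>x\<bar>"])
      show "integrable \<nu> (\<lambda>x. (2 + B) * min 1 \<bar>x\<bar>)"
        using fv_levy_measure_integrable(1)[OF assms] by simp
      show "AE x in \<nu>. (\<lambda>n. iexp (v n * x) - 1) \<longlonglongrightarrow> iexp (u * x) - 1"
        using v by (intro AE_I2 tendsto_intros)
      have "cmod (iexp (v n * x) - 1) \<le> (2 + B) * min 1 \<bar>x\<bar>" for n x
        using B[of n] by (intro order_trans[OF cmod_iexp_minus_1_le] mult_right_mono) auto
      then show "AE x in \<nu>. norm (iexp (v n * x) - 1) \<le> (2 + B) * min 1 \<bar>x\<bar>" for n by simp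
    qed measurable
    then show "((\<lambda>u. CLINT x|\<nu>. iexp (u * x) - 1) \<circ> v) \<longlonglongrightarrow> (CLINT x|\<nu>. iexp (u * x) - 1)"
      by (simp add: comp_def)
  qed
  then show ?thesis
    unfolding fv_exponent_def by (intro continuous_intros)
qed

text \<open>A continuous logarithm of the characteristic function that vanishes at \<open>0\<close> is unique, so the
  law at the single time \<open>1\<close> determines the exponent.\<close>

lemma fv_levy_process_measure_eqI_time_1:
  assumes X: "fv_levy_process M X \<gamma> \<nu>" and \<nu>': "fv_levy_measure \<nu>'"
    and char: "\<And>u. char (distr M borel (X 1)) u = exp (fv_exponent \<gamma>' \<nu>' u)"
  shows "\<nu> = \<nu>'"
proof (rule fv_exponent_unique)
  show \<nu>: "fv_levy_measure \<nu>" using X by (simp add: fv_levy_process_def)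
  let ?d = "\<lambda>u. fv_exponent \<gamma> \<nu> u - fv_exponent \<gamma>' \<nu>' u"
  have cont: "continuous_on UNIV ?d"
    using isCont_fv_exponent[OF \<nu>] isCont_fv_exponent[OF \<nu>']
    by (intro continuous_at_imp_continuous_on ballI continuous_diff) auto
  have "exp (fv_exponent \<gamma> \<nu> u) = exp (fv_exponent \<gamma>' \<nu>' u)" for u
    using X char[of u] unfolding fv_levy_process_def by (metis mult_1 of_real_1 zero_le_one)
  then have "exp (?d u) = 1" for u by (simp add: exp_diff)
  then have d: "\<exists>n::int. ?d u = Complex 0 (of_int (2 * n) * pi)" for u
    unfolding exp_eq_1 by (auto simp: complex_eq_iff)
  \<comment> \<open>The difference takes values in the lattice of multiples of 2 pi i, whose
    distinct points are at least 2 pi apart; a continuous function on the line with such values is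
    constant.\<close>
  have discrete: "2 * pi \<le> norm (?d y - ?d x)" if "?d y \<noteq> ?d x" for x y
  proof -
    obtain m n :: int where m: "?d x = Complex 0 (of_int (2 * m) * pi)"
      and n: "?d y = Complex 0 (of_int (2 * n) * pi)"
      using d by meson
    have "n \<noteq> m" using that m n by auto
    then have "1 \<le> \<bar>real_of_int (n - m)\<bar>" by linarith
    then have "2 * pi * 1 \<le> 2 * pi * \<bar>real_of_int (n - m)\<bar>" by (intro mult_left_mono) auto
    also have "\<dots> = norm (?d y - ?d x)"
    proof -
      have "?d y - ?d x = Complex 0 (2 * pi * of_int (n - m))"
        unfolding m n by (simp add: complex_eq_iff algebra_simps)
      also have "norm \<dots> = 2 * pi * \<bar>of_int (n - m)\<bar>" by (simp add: complex_norm abs_mult)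
      finally show ?thesis by simp
    qed
    finally show ?thesis by simp
  qed
  have "?d constant_on UNIV"
    using cont discrete by (intro continuous_discrete_range_constant) (auto intro!: exI[of _ "2 * pi"])
  then obtain z where z: "\<And>u. ?d u = z" by (auto simp: constant_on_def)
  \<comment> \<open>Both exponents vanish at 0, so the constant is 0.\<close>
  then show "fv_exponent \<gamma> \<nu> u = fv_exponent \<gamma>' \<nu>' u" for u
    using z[of u] z[of 0] by (simp add: fv_exponent_def)
qed (fact \<nu>')

lemma fv_exponent_density:
  assumes "h \<in> borel_measurable borel" "\<And>x. 0 \<le> h x"
  shows "fv_exponent \<gamma> (density lborel (\<lambda>x. ennreal (h x))) u
    = \<i> * of_real (\<gamma> * u) + (CLINT x|lborel. h x *\<^sub>R (iexp (u * x) - 1))"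
  unfolding fv_exponent_def using assms by (subst integral_density) auto

text \<open>Pitfall: in \<open>compound_poisson_process\<close> the two arguments of \<open>indep_var\<close> must have the same
  type, so the counting process is coerced to a sequence and only \<open>(N n)\<close>, \<open>n\<close> a natural number,
  is assumed to be independent of the jumps. Hence the restriction to time \<open>1\<close>.\<close>

lemma (in prob_space) char_compound_poisson:
  assumes "compound_poisson_process M L c \<mu>" and L: "L 1 \<in> borel_measurable M"
  shows "char (distr M borel (L 1)) u = exp (of_real c * (char \<mu> u - 1))"
proof -
  obtain N :: "real \<Rightarrow> 'a \<Rightarrow> nat" and Y :: "nat \<Rightarrow> 'a \<Rightarrow> real" where
    c: "0 < c" and N: "poisson_process M N c" and Y: "indep_vars (\<lambda>_. borel) Y UNIV"
    and \<mu>: "\<And>k. distr M borel (Y k) = \<mu>"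
    and NY: "indep_var (PiM {0..} (\<lambda>_. borel)) (\<lambda>\<omega> n. (\<lambda>t\<in>{0..}. real (N t \<omega>)) (real n))
          (PiM UNIV (\<lambda>_. borel)) (\<lambda>\<omega> k. Y k \<omega>)"
    and L_eq: "AE \<omega> in M. L 1 \<omega> = (\<Sum>k<N 1 \<omega>. Y k \<omega>)"
    using assms unfolding compound_poisson_process_def by auto
  have [measurable]: "L 1 \<in> borel_measurable M" by fact
  have Y_meas [measurable]: "Y k \<in> borel_measurable M" for k
    using Y by (auto simp: indep_vars_def)
  have N_real [measurable]: "(\<lambda>\<omega>. real (N 1 \<omega>)) \<in> borel_measurable M"
    using N by (simp add: poisson_process_def levy_process_def)
  have "(\<lambda>\<omega>. nat \<lfloor>real (N 1 \<omega>)\<rfloor>) \<in> measurable M (count_space UNIV)" by measurable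
  then have N_meas [measurable]: "N 1 \<in> measurable M (count_space UNIV)" by simp
  \<comment> \<open>Splitting by the number \<open>n\<close> of jumps up to time 1 replaces the
    random number of summands by a fixed one; independence of the count and the jumps then factors
    each term.\<close>
  define f where "f = (\<lambda>n \<omega>. complex_of_real (indicator {real n} (real (N 1 \<omega>))) * iexp (u * (\<Sum>k<n. Y k \<omega>)))"
  have f_meas [measurable]: "f n \<in> borel_measurable M" for n unfolding f_def by measurable
  have f_int: "complex_integrable M (f n)" for n
    by (rule integrable_const_bound[where B=1]) (auto simp: f_def norm_mult indicator_def)
  have prob_N: "(\<integral>\<omega>. indicator {real n} (real (N 1 \<omega>)) \<partial>M) = c ^ n / fact n * exp (- c)" for n
  proof -
    have "(\<integral>\<omega>. indicator {real n} (real (N 1 \<omega>)) \<partial>M) = (\<integral>\<omega>. indicator (N 1 -` {n} \<inter> space M) \<omega> \<partial>M)"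
      by (intro Bochner_Integration.integral_cong) (auto simp: indicator_def)
    also have "\<dots> = measure (distr M (count_space UNIV) (N 1)) {n}"
      by (simp add: measure_distr)
    also have "\<dots> = pmf (poisson_pmf c) n"
      using N by (simp add: poisson_process_def measure_pmf_single)
    finally show ?thesis using c by simp
  qed
  have f_integral: "(CLINT \<omega>|M. f n \<omega>) = of_real (c ^ n / fact n * exp (- c)) * char \<mu> u ^ n" for n
  proof -
    have "indep_var
        borel ((\<lambda>g. complex_of_real (indicator {real n} (g (1::nat)))) \<circ>
          (\<lambda>\<omega> n. (\<lambda>t\<in>{0..}. real (N t \<omega>)) (real n)))
        borel ((\<lambda>y. iexp (u * (\<Sum>k<n. y k))) \<circ> (\<lambda>\<omega> k. Y k \<omega>))"
    proof (rule indep_var_compose[OF NY])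
      have [measurable]: "(\<lambda>g. g (1::nat)) \<in> measurable (PiM {0..} (\<lambda>_. borel)) (borel :: real measure)"
        by (intro measurable_component_singleton) simp
      show "(\<lambda>g. complex_of_real (indicator {real n} (g (1::nat)))) \<in> borel_measurable (PiM {0..} (\<lambda>_. borel))"
        by measurable
    qed measurable
    then have "indep_var borel (\<lambda>\<omega>. complex_of_real (indicator {real n} (real (N 1 \<omega>))))
        borel (\<lambda>\<omega>. iexp (u * (\<Sum>k<n. Y k \<omega>)))"
      by (simp add: comp_def)
    then have "(CLINT \<omega>|M. f n \<omega>) = (CLINT \<omega>|M. complex_of_real (indicator {real n} (real (N 1 \<omega>))))
        * (CLINT \<omega>|M. iexp (u * (\<Sum>k<n. Y k \<omega>)))"
      unfolding f_def
      by (rule indep_var_lebesgue_integral)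
         (auto intro!: integrable_const_bound[where B=1] simp: indicator_def)
    also have "(CLINT \<omega>|M. complex_of_real (indicator {real n} (real (N 1 \<omega>))))
        = of_real (c ^ n / fact n * exp (- c))"
      using prob_N[of n] by simp
    also have "(CLINT \<omega>|M. iexp (u * (\<Sum>k<n. Y k \<omega>))) = char (distr M borel (\<lambda>\<omega>. \<Sum>k<n. Y k \<omega>)) u"
      unfolding char_def by (subst integral_distr) auto
    also have "\<dots> = (\<Prod>k<n. char (distr M borel (Y k)) u)"
      by (rule char_distr_sum[OF indep_vars_subset[OF Y]]) simp
    also have "\<dots> = char \<mu> u ^ n" by (simp add: \<mu>)
    finally show ?thesis .
  qed
  have f_fin: "f n \<omega> = 0" if "n \<notin> {N 1 \<omega>}" for n \<omega> using that by (simp add: f_def)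
  \<comment> \<open>Sum and expectation may be exchanged: pointwise at most one term is nonzero, and
    the norms integrate to the Poisson probabilities.\<close>
  have "(\<lambda>n. CLINT \<omega>|M. f n \<omega>) sums (CLINT \<omega>|M. (\<Sum>n. f n \<omega>))"
  proof (rule sums_integral[OF f_int])
    show "AE \<omega> in M. summable (\<lambda>n. norm (f n \<omega>))"
      using f_fin by (intro AE_I2 summable_finite[where N="{N 1 _}"]) auto
    have "(\<integral>\<omega>. norm (f n \<omega>) \<partial>M) = c ^ n / fact n * exp (- c)" for n
      using prob_N[of n] by (simp add: f_def norm_mult)
    then show "summable (\<lambda>n. \<integral>\<omega>. norm (f n \<omega>) \<partial>M)"
      using summable_exp[of c] by (simp add: divide_inverse mult.commute summable_mult2 del: exp_minus)
  qed
  moreover have "(\<lambda>n. CLINT \<omega>|M. f n \<omega>) sums exp (of_real c * (char \<mu> u - 1))"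
  proof -
    have "(\<lambda>n. (of_real c * char \<mu> u) ^ n /\<^sub>R fact n * exp (- of_real c)) sums
        (exp (of_real c * char \<mu> u) * exp (- of_real c))"
      by (intro sums_mult2 exp_converges)
    also have "exp (of_real c * char \<mu> u) * exp (- of_real c) = exp (of_real c * (char \<mu> u - 1))"
      by (simp add: right_diff_distrib flip: exp_add)
    finally show ?thesis
      by (simp add: f_integral power_mult_distrib scaleR_conv_of_real field_simps exp_of_real flip: of_real_minus)
  qed
  ultimately have "(CLINT \<omega>|M. (\<Sum>n. f n \<omega>)) = exp (of_real c * (char \<mu> u - 1))"
    by (rule sums_unique2)
  moreover have "char (distr M borel (L 1)) u = (CLINT \<omega>|M. (\<Sum>n. f n \<omega>))"
  proof -
    have "(\<Sum>n. f n \<omega>) = iexp (u * (\<Sum>k<N 1 \<omega>. Y k \<omega>))" for \<omega>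
      using suminf_finite[of "{N 1 \<omega>}" "\<lambda>n. f n \<omega>"] f_fin by (simp add: f_def)
    moreover have "char (distr M borel (L 1)) u = (CLINT \<omega>|M. iexp (u * L 1 \<omega>))"
      unfolding char_def by (subst integral_distr) auto
    moreover have "\<dots> = (CLINT \<omega>|M. iexp (u * (\<Sum>k<N 1 \<omega>. Y k \<omega>)))"
      using L_eq by (intro integral_cong_AE) (auto elim!: eventually_mono)
    ultimately show ?thesis by simp
  qed
  ultimately show ?thesis by simp
qed

text \<open>At time s / \<alpha> the shape parameter is s. Since Gamma (s) = Gamma (s + 1) / s,
  dividing the density by the time cancels the vanishing normalising factor and leaves a function
  tending to \<alpha> exp (- l x) / x, the Levy density; dominated convergence passes this to the
  integral.\<close>

lemma (in prob_space) tendsto_char_gamma: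
  fixes s :: "nat \<Rightarrow> real"
  assumes \<alpha>: "0 < \<alpha>" and l: "0 < l"
    and dist: "\<And>n. distributed M lborel (X (s n / \<alpha>)) (\<lambda>x. ennreal (gamma_density (s n) l x))"
    and s: "s \<longlonglongrightarrow> 0" "\<And>n. 0 < s n" "\<And>n. s n \<le> 1"
  shows "(\<lambda>n. (char (distr M borel (X (s n / \<alpha>))) u - 1) / of_real (s n / \<alpha>))
    \<longlonglongrightarrow> (CLINT x|lborel. (gamma_k \<alpha> l x / \<bar>x\<bar>) *\<^sub>R (iexp (u * x) - 1))"
proof -
  define c where "c = (\<lambda>n. l powr s n / Gamma (s n + 1))"
  have "(\<lambda>n. Gamma (s n + 1)) \<longlonglongrightarrow> Gamma (0 + 1)"
    by (intro tendsto_Gamma tendsto_add s tendsto_const) (auto simp: nonpos_Ints_def)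
  moreover have "(\<lambda>n. l powr s n) \<longlonglongrightarrow> l powr 0"
    using l by (intro tendsto_powr tendsto_const s) auto
  ultimately have c_lim: "c \<longlonglongrightarrow> 1"
    using l tendsto_divide[of "\<lambda>n. l powr s n" 1 sequentially "\<lambda>n. Gamma (s n + 1)" 1]
    by (simp add: c_def)
  then obtain B where B: "\<And>n. \<bar>c n\<bar> \<le> B"
    by (metis convergentI convergent_imp_Bseq BseqE real_norm_def)
  define g where "g = (\<lambda>n x. if 0 < x then \<alpha> * c n * x powr s n * exp (- l * x) / x else 0)"
  have g_eq: "gamma_density (s n) l x / (s n / \<alpha>) = g n x" for n x
  proof (cases "0 < x")
    case True
    have "Gamma (s n + 1) = s n * Gamma (s n)"
      using s(2)[of n] by (intro Gamma_plus1) (auto dest: nonpos_Ints_nonpos)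
    then show ?thesis
      using True s(2)[of n] by (simp add: gamma_density_def g_def c_def powr_diff mult_ac)
  qed (simp add: gamma_density_def g_def)
  have [measurable]: "g n \<in> borel_measurable borel" "gamma_density a l \<in> borel_measurable borel" for n a
    unfolding g_def gamma_density_def by measurable
  have char_eq: "(char (distr M borel (X (s n / \<alpha>))) u - 1) / of_real (s n / \<alpha>)
      = (CLINT x|lborel. g n x *\<^sub>R (iexp (u * x) - 1))" for n
  proof -
    let ?X = "X (s n / \<alpha>)" and ?p = "gamma_density (s n) l"
    have X [measurable]: "?X \<in> borel_measurable M"
      using dist[of n] by (simp add: distributed_def)
    interpret X: prob_space "distr M borel ?X" by (rule prob_space_distr) fact
    have "distr M borel ?X = distr M lborel ?X" by (rule distr_cong) auto
    then have distr: "distr M borel ?X = density lborel (\<lambda>x. ennreal (?p x))"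
      using dist[of n] by (simp add: distributed_def)
    have p0: "0 \<le> ?p x" for x
      using s(2)[of n]
      by (auto simp: gamma_density_def intro!: mult_nonneg_nonneg divide_nonneg_nonneg Gamma_real_nonneg)
    \<comment> \<open>The 1 is the total mass and goes under the integral, where it tames the factor
      1 / x that the limit density has at 0.\<close>
    have "char (distr M borel ?X) u - 1 = (CLINT x|distr M borel ?X. iexp (u * x) - 1)"
      unfolding char_def
      by (subst Bochner_Integration.integral_diff)
         (auto intro!: X.integrable_const_bound[where B=1] simp: X.prob_space[simplified])
    also have "\<dots> = (CLINT x|lborel. ?p x *\<^sub>R (iexp (u * x) - 1))"
      unfolding distr using p0 by (intro integral_density) auto
    finally have "(char (distr M borel ?X) u - 1) / of_real (s n / \<alpha>)
        = (CLINT x|lborel. ?p x *\<^sub>R (iexp (u * x) - 1)) / of_real (s n / \<alpha>)" by simp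
    also have "\<dots> = (CLINT x|lborel. (?p x *\<^sub>R (iexp (u * x) - 1)) / of_real (s n / \<alpha>))"
      by (rule integral_divide_zero[symmetric])
    also have "\<dots> = (CLINT x|lborel. g n x *\<^sub>R (iexp (u * x) - 1))"
      unfolding g_eq[symmetric] by (intro Bochner_Integration.integral_cong) (auto simp: scaleR_conv_of_real)
    finally show ?thesis .
  qed
  \<comment> \<open>\<open>iexp (u * x) - 1\<close> supplies \<bar>u\<bar> x against the 1 / x in
    \<open>g n\<close>, \<open>B\<close> bounds the constants \<open>c n\<close>, and
    \<open>x powr s n\<close> is at most 1 + x because \<open>s n\<close> lies in (0, 1].\<close>
  let ?w = "\<lambda>x. \<alpha> * B * \<bar>u\<bar> * (2 * ((1 + x\<^sup>2) * exp (- l * x) * indicator {0<..} x))"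
  have "(\<lambda>n. CLINT x|lborel. g n x *\<^sub>R (iexp (u * x) - 1))
      \<longlonglongrightarrow> (CLINT x|lborel. (gamma_k \<alpha> l x / \<bar>x\<bar>) *\<^sub>R (iexp (u * x) - 1))"
  proof (rule integral_dominated_convergence[where w="?w"])
    have "integrable lborel (\<lambda>x. (1 + x\<^sup>2) * exp (- l * x) * indicator {0<..} x)"
      using nn_integral_power2_exp_decay_finite[OF l]
      by (intro integrableI_nonneg) (auto intro!: AE_I2 mult_nonneg_nonneg)
    then show "integrable lborel ?w" by (intro integrable_mult_right)
    show "AE x in lborel. (\<lambda>n. g n x *\<^sub>R (iexp (u * x) - 1)) \<longlonglongrightarrow> (gamma_k \<alpha> l x / \<bar>x\<bar>) *\<^sub>R (iexp (u * x) - 1)"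
    proof (intro AE_I2 tendsto_scaleR tendsto_const)
      fix x
      show "(\<lambda>n. g n x) \<longlonglongrightarrow> gamma_k \<alpha> l x / \<bar>x\<bar>"
      proof (cases "0 < x")
        case True
        have "(\<lambda>n. \<alpha> * c n * x powr s n * exp (- l * x) / x) \<longlonglongrightarrow> \<alpha> * 1 * x powr 0 * exp (- l * x) / x"
          using True by (intro tendsto_intros c_lim s) auto
        then show ?thesis using True by (simp add: g_def gamma_k_def)
      qed (simp add: g_def gamma_k_def)
    qed
    show "AE x in lborel. norm (g n x *\<^sub>R (iexp (u * x) - 1)) \<le> ?w x" for n
    proof (rule AE_I2)
      fix x
      show "norm (g n x *\<^sub>R (iexp (u * x) - 1)) \<le> ?w x"
      proof (cases "0 < x")
        case True
        have "x powr s n \<le> 1 + x"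
        proof (cases "x \<le> 1")
          case le: True
          then have "x powr s n \<le> x powr 0" using True s(2)[of n] by (intro powr_mono') auto
          then show ?thesis using True by simp
        next
          case False
          then have "x powr s n \<le> x powr 1" using s(3)[of n] by (intro powr_mono) auto
          then show ?thesis using True by simp
        qed
        also have "1 + x \<le> 2 * (1 + x\<^sup>2)"
        proof -
          \<comment> \<open>Completing the square: 2 (1 + x^2) - (1 + x) = 2 (x - 1/4)^2 +
            7/8.\<close>
          have "0 \<le> (x - 1 / 4)\<^sup>2" by simp
          then show ?thesis by (simp add: power2_eq_square algebra_simps)
        qed
        finally have powr: "x powr s n \<le> 2 * (1 + x\<^sup>2)" .
        have "cmod (iexp (u * x) - 1) \<le> \<bar>u\<bar> * x"
          using iexp_approx1[of "u * x" 0] True by (simp add: abs_mult)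
        then have "norm (g n x *\<^sub>R (iexp (u * x) - 1)) \<le> \<bar>g n x\<bar> * (\<bar>u\<bar> * x)"
          by (simp add: mult_left_mono)
        also have "\<dots> = \<alpha> * \<bar>c n\<bar> * \<bar>u\<bar> * (x powr s n * exp (- l * x))"
          using True \<alpha> by (simp add: g_def abs_mult)
        also have "\<dots> \<le> \<alpha> * B * \<bar>u\<bar> * (2 * (1 + x\<^sup>2) * exp (- l * x))"
          using \<alpha> B[of n] powr by (intro mult_mono mult_nonneg_nonneg) auto
        also have "\<dots> = ?w x" using True by (simp del: distrib_left_numeral distrib_right_numeral)
        finally show ?thesis .
      qed (simp add: g_def)
    qed
  qed (auto simp: gamma_k_def)
  then show ?thesis by (simp only: char_eq)
qed

section \<open>Levy densities of the admissible components and of their sum\<close>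

text \<open>At time 1 the exponent is \<open>c\<close> times (char \<mu> - 1), \<mu> being the jump
  law. This is an exponent with drift 0 and Levy density \<open>c * f\<close>, to which uniqueness
  applies.\<close>

lemma fv_levy_process_compound_poisson:
  assumes X: "fv_levy_process M X \<gamma> \<nu>" and reg: "regular_compound_poisson M X"
  obtains h where "regular_levy_density h 0" "\<nu> = density lborel (\<lambda>x. ennreal (h x))"
proof -
  obtain c f \<epsilon> where [measurable]: "f \<in> borel_measurable borel" and f0: "\<And>x. 0 \<le> f x"
    and cp: "compound_poisson_process M X c (density lborel (\<lambda>x. ennreal (f x)))"
    and bv: "bounded_variation_on UNIV (\<lambda>x. x * f x)" and \<epsilon>: "0 < \<epsilon>"
    and moment: "(\<integral>\<^sup>+ x. ennreal (\<bar>x\<bar> powr (2 + \<epsilon>) * f x) \<partial>lborel) < \<infinity>"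
    using reg unfolding regular_compound_poisson_def by auto
  interpret prob_space M using X by (simp add: fv_levy_process_def levy_process_def)
  let ?\<mu> = "density lborel (\<lambda>x. ennreal (f x))" and ?h = "\<lambda>x. c * f x"
  have c: "0 < c" using cp by (simp add: compound_poisson_process_def)
  have X1: "X 1 \<in> borel_measurable M" using X by (simp add: fv_levy_process_def levy_process_def)
  obtain Y :: "nat \<Rightarrow> 'a \<Rightarrow> real" where "indep_vars (\<lambda>_. borel) Y UNIV" "distr M borel (Y 0) = ?\<mu>"
    using cp unfolding compound_poisson_process_def by blast
  then have "prob_space ?\<mu>"
    using prob_space_distr[of "Y 0" borel] by (simp add: indep_vars_def)
  then interpret \<mu>: prob_space ?\<mu> .
  \<comment> \<open>As the law of a jump, \<open>f\<close> has mass 1; this makes the Levy measure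
    finite and the activity 0.\<close>
  have f1: "(\<integral>\<^sup>+x. ennreal (f x) \<partial>lborel) = 1"
    using \<mu>.emeasure_space_1 by (simp add: emeasure_density)
  have reg_h: "regular_levy_density ?h 0"
  proof (rule regular_levy_density_finite_activity)
    show "bounded_variation_on UNIV (\<lambda>x. x * ?h x)"
      using bounded_variation_on_cmult[OF bv, of c] by (simp add: mult_ac)
    show "(\<integral>\<^sup>+x. ennreal (?h x) \<partial>lborel) < \<infinity>"
      using c f0 by (simp add: ennreal_mult nn_integral_cmult f1)
    have "(\<integral>\<^sup>+x. ennreal (\<bar>x\<bar> powr (2 + \<epsilon>) * ?h x) \<partial>lborel)
        = (\<integral>\<^sup>+x. ennreal c * ennreal (\<bar>x\<bar> powr (2 + \<epsilon>) * f x) \<partial>lborel)"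
      using c f0 by (intro nn_integral_cong) (simp add: mult_ac flip: ennreal_mult)
    also have "\<dots> < \<infinity>"
      using moment by (simp add: nn_integral_cmult ennreal_mult_less_top)
    finally show "(\<integral>\<^sup>+x. ennreal (\<bar>x\<bar> powr (2 + \<epsilon>) * ?h x) \<partial>lborel) < \<infinity>" .
  qed (use c f0 \<epsilon> in auto)
  have "\<nu> = density lborel (\<lambda>x. ennreal (?h x))"
  proof (rule fv_levy_process_measure_eqI_time_1[OF X regular_levy_density_fv[OF reg_h]])
    fix u
    have int: "complex_integrable ?\<mu> (\<lambda>x. iexp (u * x))"
      by (rule \<mu>.integrable_const_bound[where B=1]) auto
    have "fv_exponent 0 (density lborel (\<lambda>x. ennreal (?h x))) u
        = (CLINT x|lborel. of_real c * (f x *\<^sub>R (iexp (u * x) - 1)))"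
      using c f0 by (subst fv_exponent_density) (auto simp: scaleR_conv_of_real mult_ac)
    also have "\<dots> = of_real c * (CLINT x|lborel. f x *\<^sub>R (iexp (u * x) - 1))"
      by (rule integral_mult_right_zero)
    also have "(CLINT x|lborel. f x *\<^sub>R (iexp (u * x) - 1)) = (CLINT x|?\<mu>. iexp (u * x) - 1)"
      by (rule integral_density[symmetric]) (auto simp: f0)
    also have "\<dots> = char ?\<mu> u - 1"
      unfolding char_def using int \<mu>.prob_space
      by (subst Bochner_Integration.integral_diff) (auto simp del: \<mu>.prob_space space_density)
    finally show "char (distr M borel (X 1)) u = exp (fv_exponent 0 (density lborel (\<lambda>x. ennreal (?h x))) u)"
      using char_compound_poisson[OF cp X1, of u] by simp
  qed
  with reg_h show thesis by (rule that)
qed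

lemma fv_levy_process_gamma:
  assumes X: "fv_levy_process M X \<gamma> \<nu>" and gamma: "gamma_process M X \<alpha> l"
  shows "\<nu> = density lborel (\<lambda>x. ennreal (gamma_k \<alpha> l x / \<bar>x\<bar>))"
proof -
  interpret prob_space M using X by (simp add: fv_levy_process_def levy_process_def)
  have pos: "0 < \<alpha>" "0 < l"
    and dist: "\<And>t. 0 < t \<Longrightarrow> distributed M lborel (X t) (\<lambda>x. ennreal (gamma_density (\<alpha> * t) l x))"
    using gamma by (auto simp: gamma_process_def)
  have [measurable]: "gamma_k \<alpha> l \<in> borel_measurable borel" unfolding gamma_k_def by measurable
  \<comment> \<open>At time \<open>?s n / \<alpha>\<close> the Gamma law has shape
    \<open>?s n\<close>, which lies in (0, 1] as the domination requires.\<close>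
  let ?s = "\<lambda>n. 1 / real (Suc n)"
  have s: "?s \<longlonglongrightarrow> 0"
    using LIMSEQ_inverse_real_of_nat by (simp add: inverse_eq_divide)
  show ?thesis
  proof (rule fv_levy_process_measure_eqI[OF X])
    show "fv_levy_measure (density lborel (\<lambda>x. ennreal (gamma_k \<alpha> l x / \<bar>x\<bar>)))"
      by (rule regular_levy_density_fv[OF regular_levy_density_gamma[OF pos]])
    show "(\<lambda>n. ?s n / \<alpha>) \<longlonglongrightarrow> 0" using tendsto_divide[OF s tendsto_const, of \<alpha>] pos by simp
    show "0 < ?s n / \<alpha>" for n using pos by simp
    show "(\<lambda>n. (char (distr M borel (X (?s n / \<alpha>))) u - 1) / of_real (?s n / \<alpha>))
        \<longlonglongrightarrow> fv_exponent 0 (density lborel (\<lambda>x. ennreal (gamma_k \<alpha> l x / \<bar>x\<bar>))) u" for u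
    proof -
      have "fv_exponent 0 (density lborel (\<lambda>x. ennreal (gamma_k \<alpha> l x / \<bar>x\<bar>))) u
          = (CLINT x|lborel. (gamma_k \<alpha> l x / \<bar>x\<bar>) *\<^sub>R (iexp (u * x) - 1))"
        using pos by (subst fv_exponent_density) (auto simp: gamma_k_def)
      moreover have "distributed M lborel (X (?s n / \<alpha>)) (\<lambda>x. ennreal (gamma_density (?s n) l x))" for n
        using dist[of "?s n / \<alpha>"] pos by simp
      ultimately show ?thesis
        using tendsto_char_gamma[where s="?s" and X=X and u=u, OF pos _ s] by simp
    qed
  qed
qed

lemma admissible_component_regular_density:
  assumes X: "fv_levy_process M X \<gamma> \<nu>" and comp: "admissible_component M X \<nu> \<kappa>"
  obtains h where "regular_levy_density h \<kappa>" "\<nu> = density lborel (\<lambda>x. ennreal (h x))"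
  using comp unfolding admissible_component_def
proof (elim disjE exE conjE)
  assume "regular_compound_poisson M X" "\<kappa> = 0"
  then show thesis using fv_levy_process_compound_poisson[OF X] that by blast
next
  fix l assume gamma: "gamma_process M X \<kappa> l"
  then have "0 < \<kappa>" "0 < l" by (auto simp: gamma_process_def)
  then show thesis
    by (rule that[OF regular_levy_density_gamma fv_levy_process_gamma[OF X gamma]])
next
  assume "regular_selfdecomposable \<nu> \<kappa>"
  then obtain k p q \<epsilon> where k: "k_function \<nu> k p q" and \<kappa>: "\<kappa> = p + q" and \<epsilon>: "0 < \<epsilon>"
    and moment: "(\<integral>\<^sup>+ x. ennreal (max 1 (\<bar>x\<bar> powr (1 + \<epsilon>)) * k x) \<partial>lborel) < \<infinity>"
    unfolding regular_selfdecomposable_def by blast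
  have "\<nu> = density lborel (\<lambda>x. ennreal (k x / \<bar>x\<bar>))" using k by (simp add: k_function_def)
  then show thesis
    using that regular_levy_density_selfdecomposable[OF k \<epsilon> moment] \<kappa> by blast
qed

text \<open>Independence multiplies the characteristic functions at time 1, so drifts and Levy
  densities add up to a candidate exponent, and uniqueness identifies \<nu>. The activities add too,
  which is where the bound on their sum enters.\<close>

lemma admissible_sum_regular_density:
  assumes L: "fv_levy_process M L \<gamma> \<nu>" and sum: "admissible_sum M L \<Delta>"
  obtains h \<kappa> where "regular_levy_density h \<kappa>" "\<kappa> < 1 / (2 * \<Delta>)" "\<nu> = density lborel (\<lambda>x. ennreal (h x))"
proof -
  interpret prob_space M using L by (simp add: fv_levy_process_def levy_process_def)
  obtain I :: "nat set" and X \<gamma>' \<nu>' \<kappa> where I: "finite I"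
    and X: "\<And>i. i \<in> I \<Longrightarrow> fv_levy_process M (X i) (\<gamma>' i) (\<nu>' i)"
    and comp: "\<And>i. i \<in> I \<Longrightarrow> admissible_component M (X i) (\<nu>' i) (\<kappa> i)"
    and indep: "indep_vars (\<lambda>_. PiM {0..} (\<lambda>_. borel)) (\<lambda>i \<omega>. \<lambda>t\<in>{0..}. X i t \<omega>) I"
    and small: "(\<Sum>i\<in>I. \<kappa> i) < 1 / (2 * \<Delta>)"
    and L_eq: "\<And>t. 0 \<le> t \<Longrightarrow> AE \<omega> in M. L t \<omega> = (\<Sum>i\<in>I. X i t \<omega>)"
    using sum unfolding admissible_sum_def by blast
  have "\<forall>i\<in>I. \<exists>h. regular_levy_density h (\<kappa> i) \<and> \<nu>' i = density lborel (\<lambda>x. ennreal (h x))"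
    using admissible_component_regular_density[OF X comp] by blast
  then obtain h where h: "\<And>i. i \<in> I \<Longrightarrow> regular_levy_density (h i) (\<kappa> i)"
    and \<nu>': "\<And>i. i \<in> I \<Longrightarrow> \<nu>' i = density lborel (\<lambda>x. ennreal (h i x))"
    by metis
  let ?h = "\<lambda>x. \<Sum>i\<in>I. h i x"
  have reg: "regular_levy_density ?h (\<Sum>i\<in>I. \<kappa> i)" by (rule regular_levy_density_sum[OF I h])
  have h_meas [measurable]: "h i \<in> borel_measurable borel" and h0: "0 \<le> h i x" if "i \<in> I" for i x
    using h[OF that] by (auto simp: regular_levy_density_def)
  have [measurable]: "?h \<in> borel_measurable borel" using reg by (simp add: regular_levy_density_def)
  have exponent: "fv_exponent (\<Sum>i\<in>I. \<gamma>' i) (density lborel (\<lambda>x. ennreal (?h x))) u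
      = (\<Sum>i\<in>I. fv_exponent (\<gamma>' i) (\<nu>' i) u)" for u
  proof -
    have int: "complex_integrable lborel (\<lambda>x. h i x *\<^sub>R (iexp (u * x) - 1))" if i: "i \<in> I" for i
    proof -
      have "complex_integrable (density lborel (\<lambda>x. ennreal (h i x))) (\<lambda>x. iexp (u * x) - 1)"
        by (rule fv_levy_measure_integrable(2)[OF regular_levy_density_fv[OF h[OF i]]])
      then show ?thesis using i h0 by (subst (asm) integrable_density) auto
    qed
    have "(\<Sum>i\<in>I. fv_exponent (\<gamma>' i) (\<nu>' i) u)
        = (\<Sum>i\<in>I. \<i> * of_real (\<gamma>' i * u) + (CLINT x|lborel. h i x *\<^sub>R (iexp (u * x) - 1)))"
      using \<nu>' h0 h_meas by (intro sum.cong refl) (simp add: fv_exponent_density)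
    also have "\<dots> = \<i> * of_real ((\<Sum>i\<in>I. \<gamma>' i) * u) + (CLINT x|lborel. \<Sum>i\<in>I. h i x *\<^sub>R (iexp (u * x) - 1))"
      using int by (simp add: sum.distrib sum_distrib_left sum_distrib_right Bochner_Integration.integral_sum)
    also have "\<dots> = fv_exponent (\<Sum>i\<in>I. \<gamma>' i) (density lborel (\<lambda>x. ennreal (?h x))) u"
      using h0 by (subst fv_exponent_density) (auto intro!: sum_nonneg simp: scaleR_sum_left)
    finally show ?thesis by simp
  qed
  have "\<nu> = density lborel (\<lambda>x. ennreal (?h x))"
  proof (rule fv_levy_process_measure_eqI_time_1[OF L regular_levy_density_fv[OF reg]])
    fix u
    have X1 [measurable]: "X i 1 \<in> borel_measurable M" if "i \<in> I" for i
      using X[OF that] by (simp add: fv_levy_process_def levy_process_def)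
    have L1 [measurable]: "L 1 \<in> borel_measurable M"
      using L by (simp add: fv_levy_process_def levy_process_def)
    \<comment> \<open>Independence of the whole paths is projected to the single time 1.\<close>
    have "indep_vars (\<lambda>_. borel) (\<lambda>i \<omega>. (\<lambda>t\<in>{0..}. X i t \<omega>) 1) I"
    proof (rule indep_vars_compose2[OF indep])
      show "(\<lambda>g. g (1::real)) \<in> measurable (PiM {0..} (\<lambda>_. borel)) borel"
        by (rule measurable_component_singleton) simp
    qed
    then have ind: "indep_vars (\<lambda>_. borel) (\<lambda>i. X i 1) I" by simp
    have "distr M borel (L 1) = distr M borel (\<lambda>\<omega>. \<Sum>i\<in>I. X i 1 \<omega>)"
      using L_eq[of 1] by (intro distr_cong_AE) (auto intro!: borel_measurable_sum)
    then have "char (distr M borel (L 1)) u = (\<Prod>i\<in>I. char (distr M borel (X i 1)) u)"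
      using char_distr_sum[OF ind] by simp
    also have "\<dots> = (\<Prod>i\<in>I. exp (fv_exponent (\<gamma>' i) (\<nu>' i) u))"
    proof (intro prod.cong refl)
      fix i assume "i \<in> I"
      then show "char (distr M borel (X i 1)) u = exp (fv_exponent (\<gamma>' i) (\<nu>' i) u)"
        using X[of i] unfolding fv_levy_process_def by (metis mult_1 of_real_1 zero_le_one)
    qed
    also have "\<dots> = exp (fv_exponent (\<Sum>i\<in>I. \<gamma>' i) (density lborel (\<lambda>x. ennreal (?h x))) u)"
      unfolding exponent by (rule exp_sum[OF I, symmetric])
    finally show "char (distr M borel (L 1)) u
        = exp (fv_exponent (\<Sum>i\<in>I. \<gamma>' i) (density lborel (\<lambda>x. ennreal (?h x))) u)" .
  qed
  with reg small show thesis by (rule that)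
qed

theorem proposition3:
  fixes M :: "'a measure" and L :: "real \<Rightarrow> 'a \<Rightarrow> real"
    and \<gamma> \<Delta> :: real and \<nu> :: "real measure" and \<phi> :: "real \<Rightarrow> complex"
  assumes "0 < \<Delta>"
    and "fv_levy_process M L \<gamma> \<nu>"
    and "\<phi> = char (distr M borel (L \<Delta>))"
  shows "(regular_compound_poisson M L \<longrightarrow> condition_A \<nu> \<phi>) \<and>
         (\<forall>\<alpha> l. 0 < \<alpha> \<and> \<alpha> < 1 / (2 * \<Delta>) \<and> 0 < l \<and> gamma_process M L \<alpha> l
            \<longrightarrow> condition_A \<nu> \<phi>) \<and>
         (\<forall>\<kappa>. regular_selfdecomposable \<nu> \<kappa> \<and> \<kappa> < 1 / (2 * \<Delta>) \<longrightarrow> condition_A \<nu> \<phi>) \<and>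
         (admissible_sum M L \<Delta> \<longrightarrow> condition_A \<nu> \<phi>)"
proof -
  have levy: "levy_process M L" using assms(2) by (simp add: fv_levy_process_def)
  interpret prob_space M using levy by (simp add: levy_process_def)
  have [measurable]: "L \<Delta> \<in> borel_measurable M" using levy assms(1) by (simp add: levy_process_def)
  interpret L: real_distribution "distr M borel (L \<Delta>)" by (rule real_distribution_distr) measurable
  have \<phi>: "\<phi> u = exp (of_real \<Delta> * fv_exponent \<gamma> \<nu> u)" for u
    using assms by (simp add: fv_levy_process_def)
  have \<phi>_meas: "\<phi> \<in> borel_measurable borel" unfolding assms(3) by (rule L.char_measurable)
  have A: "condition_A \<nu> \<phi>"
    if "regular_levy_density h \<kappa>" "\<nu> = density lborel (\<lambda>x. ennreal (h x))" "\<kappa> < 1 / (2 * \<Delta>)" for h \<kappa>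
    using that by (intro regular_levy_density_condition_A[OF _ assms(1) _ _ \<phi>_meas \<phi>]) auto
  \<comment> \<open>Cases (i) to (iii) concern a single component, namely \<open>L\<close>
    itself.\<close>
  have component: "condition_A \<nu> \<phi>" if "admissible_component M L \<nu> \<kappa>" "\<kappa> < 1 / (2 * \<Delta>)" for \<kappa>
    using admissible_component_regular_density[OF assms(2) that(1)] A that(2) by metis
  \<comment> \<open>The smallness condition of the compound Poisson case, where the activity is
    0.\<close>
  have "0 < 1 / (2 * \<Delta>)" using assms(1) by simp
  then show ?thesis
    using component A admissible_sum_regular_density[OF assms(2)]
    unfolding admissible_component_def by metis
qed

end
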